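(* Let $p$ be a prime number, $K$ a field of characteristic $p$, $n\geq 1$, and $L_n=K[x_1^{\pm 1},\ldots,x_n^{\pm 1}]$. Then the map $$\mathbb{Z}_p^n\to \mathrm{st}(L_n),\qquad s\mapsto\sigma_s,$$ is an isomorphism of groups.
   Context: $\mathbb{N}=\{0,1,\ldots\}$; $\mathbb{Z}_p$ is the ring of $p$-adic integers (with $\mathbb{Z}_p^n$ viewed as an additive group). $\mathcal{D}(L_n)\subseteq\mathrm{End}_K(L_n)$ is the ring of $K$-linear differential operators on $L_n$. One has $\mathcal{D}(L_n)=\bigoplus_{\alpha\in\mathbb{N}^n}L_n\partial^{[\alpha]}$, where $\partial^{[\alpha]}=\prod_{i=1}^n\frac{\partial_i^{\alpha_i}}{\alpha_i!}$ is the $K$-linear operator on $L_n$ with $\partial^{[\alpha]}(x^\beta)=\prod_i\binom{\beta_i}{\alpha_i}x^{\beta-\alpha}$ for $\beta\in\mathbb{Z}^n$, and elements of $L_n$ act by multiplication. $\mathrm{Aut}_K$ denotes the group of $K$-algebra automorphisms, and $$\mathrm{st}(L_n)=\{\sigma\in\mathrm{Aut}_K(\mathcal{D}(L_n)) \mid \sigma(a)=a \text{ for all } a\in L_n\}.$$ For $s=(s_i)\in\mathbb{Z}_p^n$, $\sigma_s\in\mathrm{st}(L_n)$ is the $K$-algebra automorphism of $\mathcal{D}(L_n)$ with $\sigma_s(x_i)=x_i$ for all $i$ and $$\sigma_s(\partial^{[\alpha]})=\prod_{i=1}^n\frac{(\partial_i+s_ix_i^{-1})^{\alpha_i}}{\alpha_i!},\qquad\alpha=(\alpha_i)\in\mathbb{N}^n.$$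 Here the right-hand side is understood as follows: over $\mathbb{Z}_p$ one has the $\mathbb{Z}_p$-linear differential operator on $\mathbb{Z}_p[x_1^{\pm1},\ldots,x_n^{\pm1}]$ $$\prod_{i=1}^n\frac{(\partial_i+s_ix_i^{-1})^{\alpha_i}}{\alpha_i!}=\prod_{i=1}^n x_i^{-\alpha_i}\binom{x_i\partial_i+s_i}{\alpha_i},\qquad \binom{t}{j}=\frac{t(t-1)\cdots(t-j+1)}{j!},\quad \binom{t}{0}=1,$$ which sends $x^\beta$ to $\prod_i\binom{\beta_i+s_i}{\alpha_i}x^{\beta-\alpha}$ for $\beta\in\mathbb{Z}^n$; the right-hand side denotes the element of $\mathcal{D}(L_n)$ obtained from it by reducing modulo $p$ and extending scalars from $\mathbb{F}_p$ to $K$. (Equivalently, $\sigma_s$ is the restriction to $\mathcal{D}(L_n)$ of the inner automorphism $b\mapsto x^{-s}bx^s$ of the larger ring $\bigoplus_{\alpha\in\mathbb{Z}_p^n,\beta\in\mathbb{N}^n}Kx^\alpha\partial^{[\beta]}$.) *)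

theory Defs
  imports
    "HOL-Library.Poly_Mapping"
    "HOL-Analysis.Finite_Cartesian_Product"
    "HOL-Number_Theory.Cong"
    "HOL-Algebra.Bij"
    "HOL-Algebra.Ring"
    "HOL-Algebra.Product_Groups"
begin

section \<open>The ring of p-adic integers\<close>

text \<open>
  The p-adic integers are the inverse limit of the rings of integers modulo \<open>p ^ k\<close>: an element is
  a compatible sequence of residues, the \<open>k\<close>-th one represented in \<open>{0..<p ^ k}\<close>.
\<close>

type_synonym padic = "nat \<Rightarrow> int"

definition padic_ring :: "nat \<Rightarrow> padic ring" where
  "padic_ring p =
    \<lparr>carrier = {a. \<forall>k. 0 \<le> a k \<and> a k < int p ^ k \<and> a (Suc k) mod int p ^ k = a k},
     mult = (\<lambda>a b k. a k * b k mod int p ^ k),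
     one = (\<lambda>k. 1 mod int p ^ k),
     zero = (\<lambda>k. 0),
     add = (\<lambda>a b k. (a k + b k) mod int p ^ k)\<rparr>"

definition padic_of_int :: "nat \<Rightarrow> int \<Rightarrow> padic" where
  "padic_of_int p m = (\<lambda>k. m mod int p ^ k)"

text \<open>
  The binomial coefficient \<open>t (t - 1) \<dots> (t - j + 1) / j!\<close>, as the unique p-adic integer whose
  product with \<open>j!\<close> is the falling factorial (see \<open>padic_binom_ex1\<close> below).
\<close>

definition padic_binom :: "nat \<Rightarrow> padic \<Rightarrow> nat \<Rightarrow> padic" where
  "padic_binom p t j =
    (THE b. b \<in> carrier (padic_ring p) \<and>
       padic_of_int p (fact j) \<otimes>\<^bsub>padic_ring p\<^esub> b =
         finprod (padic_ring p) (\<lambda>i. t \<ominus>\<^bsub>padic_ring p\<^esub> padic_of_int p (int i)) {..<j})"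

definition padic_vectors :: "nat \<Rightarrow> ('n \<Rightarrow> padic) monoid" where
  "padic_vectors p = product_group UNIV (\<lambda>_. add_monoid (padic_ring p))"

section \<open>Laurent polynomials and differential operators\<close>

text \<open>
  The Laurent polynomial ring over \<open>'k\<close> in variables indexed by \<open>'n\<close> is the group algebra of
  \<open>int ^ 'n\<close>; \<open>Poly_Mapping.single \<beta> c\<close> is the term with coefficient \<open>c\<close> and exponent vector \<open>\<beta>\<close>.
\<close>

type_synonym ('n, 'k) laurent = "(int ^ 'n) \<Rightarrow>\<^sub>0 'k"

type_synonym ('n, 'k) laurent_op = "('n, 'k) laurent \<Rightarrow> ('n, 'k) laurent"

definition laurent_var :: "'n \<Rightarrow> ('n::finite, 'k::field) laurent" where
  "laurent_var i = Poly_Mapping.single (axis i 1) 1"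

definition laurent_scale :: "'k \<Rightarrow> ('n::finite, 'k::field) laurent_op" where
  "laurent_scale c f = Poly_Mapping.single 0 c * f"

abbreviation K_linear :: "('n::finite, 'k::field) laurent_op \<Rightarrow> bool" where
  "K_linear \<equiv> Vector_Spaces.linear laurent_scale laurent_scale"

definition mult_op :: "('n::finite, 'k::field) laurent \<Rightarrow> ('n, 'k) laurent_op" where
  "mult_op a = (\<lambda>f. a * f)"

definition commutator ::
  "('n::finite, 'k::field) laurent_op \<Rightarrow> ('n, 'k) laurent_op \<Rightarrow> ('n, 'k) laurent_op" where
  "commutator u v = (\<lambda>f. u (v f) - v (u f))"

text \<open>\<open>diff_ops m\<close> is the set of differential operators of order at most \<open>m\<close>, in Grothendieck's sense.\<close>

primrec diff_ops :: "nat \<Rightarrow> ('n::finite, 'k::field) laurent_op set" where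
  "diff_ops 0 = {u. K_linear u \<and> (\<forall>a. commutator (mult_op a) u = (\<lambda>_. 0))}"
| "diff_ops (Suc m) = {u. K_linear u \<and> (\<forall>a. commutator (mult_op a) u \<in> diff_ops m)}"

definition diff_ring :: "('n::finite, 'k::field) laurent_op ring" where
  "diff_ring =
    \<lparr>carrier = (\<Union>m. diff_ops m), mult = (\<circ>), one = id,
     zero = (\<lambda>_. 0), add = (\<lambda>u v f. u f + v f)\<rparr>"

text \<open>\<open>monomial_op \<alpha> c\<close> is the \<open>K\<close>-linear operator sending each \<open>x\<^sup>\<beta>\<close> to \<open>c \<beta> x\<^sup>\<beta>\<^sup>-\<^sup>\<alpha>\<close>.\<close>

definition monomial_op :: "nat ^ 'n \<Rightarrow> (int ^ 'n \<Rightarrow> 'k) \<Rightarrow> ('n::finite, 'k::field) laurent_op" where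
  "monomial_op \<alpha> c f =
    (\<Sum>\<beta>\<in>Poly_Mapping.keys f.
       Poly_Mapping.single (\<beta> - (\<chi> i. int (\<alpha> $ i))) (c \<beta> * Poly_Mapping.lookup f \<beta>))"

text \<open>
  The division is exact (see \<open>int_binom_mult_fact\<close>). This is \<open>gbinomial\<close> on integers; importing
  \<open>Poly_Mapping\<close> restricts that constant's parsing to fields, so it cannot be written here directly.
\<close>

definition int_binom :: "int \<Rightarrow> nat \<Rightarrow> int" where
  "int_binom t j = (\<Prod>i<j. t - int i) div fact j"

definition divided_diff :: "nat ^ 'n \<Rightarrow> ('n::finite, 'k::field) laurent_op" where
  "divided_diff \<alpha> = monomial_op \<alpha> (\<lambda>\<beta>. of_int (\<Prod>i\<in>UNIV. int_binom (\<beta> $ i) (\<alpha> $ i)))"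

text \<open>
  The operator \<open>\<Prod>i. (\<partial>\<^sub>i + s\<^sub>i x\<^sub>i\<^sup>-\<^sup>1)\<^sup>\<alpha>\<^sup>i / \<alpha>\<^sub>i!\<close>. The p-adic coefficient
  of \<open>x\<^sup>\<beta>\<^sup>-\<^sup>\<alpha>\<close> in the image of \<open>x\<^sup>\<beta>\<close> is reduced modulo \<open>p\<close> by taking its component at index 1, and
  the residue is then mapped to the field, which is meaningful when \<open>CHAR('k) = p\<close>.
\<close>

definition shifted_divided_diff ::
  "nat \<Rightarrow> ('n \<Rightarrow> padic) \<Rightarrow> nat ^ 'n \<Rightarrow> ('n::finite, 'k::field) laurent_op" where
  "shifted_divided_diff p s \<alpha> =
    monomial_op \<alpha> (\<lambda>\<beta>. of_int
      (finprod (padic_ring p)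
        (\<lambda>i. padic_binom p (padic_of_int p (\<beta> $ i) \<oplus>\<^bsub>padic_ring p\<^esub> s i) (\<alpha> $ i)) UNIV 1))"

section \<open>Automorphism groups\<close>

text \<open>As in \<^const>\<open>AutoGroup\<close>, automorphisms are taken to be \<^const>\<open>extensional\<close> on the carrier.\<close>

definition diff_aut :: "(('n::finite, 'k::field) laurent_op \<Rightarrow> ('n, 'k) laurent_op) monoid" where
  "diff_aut = BijGroup (carrier diff_ring)
    \<lparr>carrier := {\<sigma> \<in> Bij (carrier diff_ring) \<inter> ring_hom diff_ring diff_ring.
       \<forall>c. \<forall>u\<in>carrier diff_ring. \<sigma> (laurent_scale c \<circ> u) = laurent_scale c \<circ> \<sigma> u}\<rparr>"

definition st_group :: "(('n::finite, 'k::field) laurent_op \<Rightarrow> ('n, 'k) laurent_op) monoid" where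
  "st_group = diff_aut\<lparr>carrier := {\<sigma> \<in> carrier diff_aut. \<forall>a. \<sigma> (mult_op a) = mult_op a}\<rparr>"

definition is_sigma ::
  "nat \<Rightarrow> ('n \<Rightarrow> padic) \<Rightarrow> (('n::finite, 'k::field) laurent_op \<Rightarrow> ('n, 'k) laurent_op) \<Rightarrow> bool" where
  "is_sigma p s \<sigma> \<longleftrightarrow>
    \<sigma> \<in> carrier diff_aut \<and>
    (\<forall>i. \<sigma> (mult_op (laurent_var i)) = mult_op (laurent_var i)) \<and>
    (\<forall>\<alpha>. \<sigma> (divided_diff \<alpha>) = shifted_divided_diff p s \<alpha>)"

definition sigma ::
  "nat \<Rightarrow> ('n \<Rightarrow> padic) \<Rightarrow> ('n::finite, 'k::field) laurent_op \<Rightarrow> ('n, 'k) laurent_op" where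
  "sigma p s = (THE \<sigma>. is_sigma p s \<sigma>)"

section \<open>Well-definedness\<close>

lemma int_binom_mult_fact: "fact j * int_binom t j = (\<Prod>i<j. t - int i)"
  using gbinomial_int_mult_fact[of j t]
  by (simp add: gbinomial_prod_rev int_binom_def atLeast0LessThan)

lemma padic_mem_iff:
  "a \<in> carrier (padic_ring p) \<longleftrightarrow> (\<forall>k. 0 \<le> a k \<and> a k < int p ^ k \<and> a (Suc k) mod int p ^ k = a k)"
  by (simp add: padic_ring_def)

lemma padic_mod: "a \<in> carrier (padic_ring p) \<Longrightarrow> a k mod int p ^ k = a k"
  by (simp add: padic_mem_iff)

lemma padic_memI:
  assumes "p > 0" and "\<And>k. [f (Suc k) = f k] (mod int p ^ k)"
  shows "(\<lambda>k. f k mod int p ^ k) \<in> carrier (padic_ring p)"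
proof -
  have "f (Suc k) mod int p ^ Suc k mod int p ^ k = f k mod int p ^ k" for k
    using assms(2)[of k] by (simp add: mod_mod_cancel cong_def)
  then show ?thesis using assms(1) by (simp add: padic_mem_iff)
qed

lemma padic_cong_Suc: "a \<in> carrier (padic_ring p) \<Longrightarrow> [a (Suc k) = a k] (mod int p ^ k)"
  by (metis padic_mem_iff padic_mod cong_def)

lemma padic_of_int_mem: "p > 0 \<Longrightarrow> padic_of_int p m \<in> carrier (padic_ring p)"
  unfolding padic_of_int_def by (rule padic_memI) auto

lemma padic_add: "a \<oplus>\<^bsub>padic_ring p\<^esub> b = (\<lambda>k. (a k + b k) mod int p ^ k)"
  by (simp add: padic_ring_def)

lemma padic_mult: "a \<otimes>\<^bsub>padic_ring p\<^esub> b = (\<lambda>k. a k * b k mod int p ^ k)"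
  by (simp add: padic_ring_def)

lemma padic_cring:
  assumes "p > 0"
  shows "cring (padic_ring p)"
proof (rule cringI)
  show "abelian_group (padic_ring p)"
  proof (rule abelian_groupI)
    fix x y assume "x \<in> carrier (padic_ring p)" "y \<in> carrier (padic_ring p)"
    then show "x \<oplus>\<^bsub>padic_ring p\<^esub> y \<in> carrier (padic_ring p)"
      unfolding padic_add by (intro padic_memI assms cong_add padic_cong_Suc)
  next
    fix x assume x: "x \<in> carrier (padic_ring p)"
    show "\<exists>y\<in>carrier (padic_ring p). y \<oplus>\<^bsub>padic_ring p\<^esub> x = \<zero>\<^bsub>padic_ring p\<^esub>"
    proof
      show "(\<lambda>k. - x k mod int p ^ k) \<in> carrier (padic_ring p)"
        by (rule padic_memI[OF assms]) (simp add: cong_minus_minus_iff padic_cong_Suc[OF x])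
    qed (simp add: padic_ring_def mod_add_left_eq)
  qed (use assms padic_mod in \<open>auto simp: padic_ring_def mod_add_left_eq mod_add_right_eq ac_simps\<close>)
  show "comm_monoid (padic_ring p)"
  proof (rule comm_monoidI)
    fix x y assume "x \<in> carrier (padic_ring p)" "y \<in> carrier (padic_ring p)"
    then show "x \<otimes>\<^bsub>padic_ring p\<^esub> y \<in> carrier (padic_ring p)"
      unfolding padic_mult by (intro padic_memI assms cong_mult padic_cong_Suc)
  next
    show "\<one>\<^bsub>padic_ring p\<^esub> \<in> carrier (padic_ring p)"
      using padic_of_int_mem[OF assms, of 1] by (simp add: padic_ring_def padic_of_int_def)
  next
    fix x assume "x \<in> carrier (padic_ring p)"
    then show "\<one>\<^bsub>padic_ring p\<^esub> \<otimes>\<^bsub>padic_ring p\<^esub> x = x"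
      using padic_mod by (auto simp: padic_ring_def mod_mult_left_eq)
  qed (auto simp: padic_ring_def mod_mult_left_eq mod_mult_right_eq ac_simps)
qed (auto simp: padic_ring_def mod_mult_left_eq mod_add_eq distrib_right)

lemma group_padic_vectors:
  assumes "p > 0"
  shows "group (padic_vectors p :: ('n \<Rightarrow> padic) monoid)"
proof -
  interpret cring "padic_ring p" by (rule padic_cring[OF assms])
  show ?thesis unfolding padic_vectors_def by (rule product_group) (rule a_group)
qed

lemma padic_minus_int:
  assumes "p > 0" and t: "t \<in> carrier (padic_ring p)"
  shows "t \<ominus>\<^bsub>padic_ring p\<^esub> padic_of_int p m = (\<lambda>k. (t k - m) mod int p ^ k)"
proof -
  interpret cring "padic_ring p" by (rule padic_cring[OF assms(1)])
  have "padic_of_int p (- m) \<oplus>\<^bsub>padic_ring p\<^esub> padic_of_int p m = \<zero>\<^bsub>padic_ring p\<^esub>"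
    by (simp add: padic_ring_def padic_of_int_def mod_add_eq)
  then have "\<ominus>\<^bsub>padic_ring p\<^esub> padic_of_int p m = padic_of_int p (- m)"
    by (rule minus_equality) (simp_all add: padic_of_int_mem assms)
  then show ?thesis
    by (simp add: a_minus_def) (simp add: padic_ring_def padic_of_int_def mod_add_right_eq)
qed

lemma padic_falling:
  assumes "p > 0" and t: "t \<in> carrier (padic_ring p)"
  shows "finprod (padic_ring p) (\<lambda>i. t \<ominus>\<^bsub>padic_ring p\<^esub> padic_of_int p (int i)) {..<j}
    = (\<lambda>k. (fact j * int_binom (t k) j) mod int p ^ k)"
proof -
  interpret cring "padic_ring p" by (rule padic_cring[OF assms(1)])
  have "finprod (padic_ring p) (\<lambda>i. t \<ominus>\<^bsub>padic_ring p\<^esub> padic_of_int p (int i)) {..<j}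
    = (\<lambda>k. (\<Prod>i<j. t k - int i) mod int p ^ k)"
  proof (induction j)
    case 0
    show ?case by simp (simp add: padic_ring_def)
  next
    case (Suc j)
    have mem: "t \<ominus>\<^bsub>padic_ring p\<^esub> padic_of_int p (int i) \<in> carrier (padic_ring p)" for i
      using padic_of_int_mem[OF assms(1)] t by simp
    have "finprod (padic_ring p) (\<lambda>i. t \<ominus>\<^bsub>padic_ring p\<^esub> padic_of_int p (int i)) {..<Suc j}
      = (t \<ominus>\<^bsub>padic_ring p\<^esub> padic_of_int p (int j)) \<otimes>\<^bsub>padic_ring p\<^esub>
        finprod (padic_ring p) (\<lambda>i. t \<ominus>\<^bsub>padic_ring p\<^esub> padic_of_int p (int i)) {..<j}"
      unfolding lessThan_Suc by (rule finprod_insert) (use mem in auto)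
    also have "\<dots> = (\<lambda>k. (\<Prod>i<Suc j. t k - int i) mod int p ^ k)"
      unfolding Suc.IH unfolding padic_minus_int[OF assms] padic_mult
      by (simp add: mod_mult_eq mult.commute)
    finally show ?case .
  qed
  then show ?thesis by (simp add: int_binom_mult_fact)
qed

lemma fact_cancel_cong:
  assumes "prime p" and "[fact j * x = fact j * y] (mod int p ^ (k + multiplicity p (fact j)))"
  shows "[x = y] (mod int p ^ k)"
proof -
  define v where "v = multiplicity p (fact j)"
  have "\<not> is_unit p" using assms(1) by auto
  then obtain u where u: "(fact j :: nat) = p ^ v * u" "\<not> p dvd u"
    using multiplicity_decompose'[of "fact j :: nat" p] unfolding v_def by (metis fact_nonzero)
  have "(fact j :: int) = int (fact j)" by simp
  also have "\<dots> = int p ^ v * int u" by (simp only: u(1) of_nat_mult of_nat_power)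
  finally have fj: "(fact j :: int) = int p ^ v * int u" .
  have "int p ^ v * int p ^ k dvd int p ^ v * (int u * (x - y))"
    using assms(2) unfolding v_def[symmetric] fj cong_iff_dvd_diff
    by (simp add: power_add algebra_simps)
  then have "int p ^ k dvd int u * (x - y)"
    using prime_gt_0_nat[OF assms(1)] by simp
  moreover have "coprime (int p ^ k) (int u)"
    using u(2) assms(1) by (simp add: prime_imp_coprime)
  ultimately show ?thesis
    by (simp add: cong_iff_dvd_diff coprime_dvd_mult_right_iff)
qed

lemma falling_cong:
  assumes "[x = y] (mod m)"
  shows "[fact j * int_binom x j = fact j * int_binom y j] (mod (m :: int))"
  unfolding int_binom_mult_fact by (intro cong_prod cong_diff assms cong_refl)

lemma padic_cong_add: "a \<in> carrier (padic_ring p) \<Longrightarrow> [a (k + v) = a k] (mod int p ^ k)"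
proof (induction v)
  case (Suc v)
  have "[a (Suc (k + v)) = a (k + v)] (mod int p ^ k)"
    using padic_cong_Suc[OF Suc.prems, of "k + v"]
    by (rule cong_dvd_modulus) (simp add: power_add)
  then show ?case using Suc by (auto intro: cong_trans)
qed auto

lemma padic_binom_ex1:
  assumes "prime p" and t: "t \<in> carrier (padic_ring p)"
  shows "\<exists>!b. b \<in> carrier (padic_ring p) \<and>
       padic_of_int p (fact j) \<otimes>\<^bsub>padic_ring p\<^esub> b =
         finprod (padic_ring p) (\<lambda>i. t \<ominus>\<^bsub>padic_ring p\<^esub> padic_of_int p (int i)) {..<j}"
proof -
  have p: "p > 0" using assms(1) by (rule prime_gt_0_nat)
  define v where "v = multiplicity p (fact j)"
  have eq_iff: "padic_of_int p (fact j) \<otimes>\<^bsub>padic_ring p\<^esub> b =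
      finprod (padic_ring p) (\<lambda>i. t \<ominus>\<^bsub>padic_ring p\<^esub> padic_of_int p (int i)) {..<j} \<longleftrightarrow>
    (\<forall>k. [fact j * b k = fact j * int_binom (t k) j] (mod int p ^ k))" for b
    unfolding padic_falling[OF p t]
    by (auto simp: padic_ring_def padic_of_int_def cong_def fun_eq_iff mod_mult_left_eq)
  show ?thesis unfolding eq_iff
  proof (rule ex_ex1I)
    let ?b = "\<lambda>k. int_binom (t (k + v)) j mod int p ^ k"
    have "?b \<in> carrier (padic_ring p)"
    proof (rule padic_memI[OF p])
      fix k
      have "[t (Suc k + v) = t (k + v)] (mod int p ^ (k + v))"
        using padic_cong_Suc[OF t, of "k + v"] by simp
      from falling_cong[OF this, of j] show "[int_binom (t (Suc k + v)) j = int_binom (t (k + v)) j] (mod int p ^ k)"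
        unfolding v_def by (rule fact_cancel_cong[OF assms(1)])
    qed
    moreover have "[fact j * ?b k = fact j * int_binom (t k) j] (mod int p ^ k)" for k
    proof -
      have "[fact j * ?b k = fact j * int_binom (t (k + v)) j] (mod int p ^ k)"
        by (simp add: cong_def mod_mult_right_eq)
      with falling_cong[OF padic_cong_add[OF t]] show ?thesis by (rule cong_trans[rotated])
    qed
    ultimately show "\<exists>b. b \<in> carrier (padic_ring p) \<and>
        (\<forall>k. [fact j * b k = fact j * int_binom (t k) j] (mod int p ^ k))" by blast
  next
    fix b c
    assume b: "b \<in> carrier (padic_ring p) \<and>
        (\<forall>k. [fact j * b k = fact j * int_binom (t k) j] (mod int p ^ k))"
      and c: "c \<in> carrier (padic_ring p) \<and>
        (\<forall>k. [fact j * c k = fact j * int_binom (t k) j] (mod int p ^ k))"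
    show "b = c"
    proof
      fix k
      have "[fact j * b (k + v) = fact j * c (k + v)] (mod int p ^ (k + v))"
        using b c by (meson cong_sym cong_trans)
      then have "[b (k + v) = c (k + v)] (mod int p ^ k)"
        unfolding v_def by (rule fact_cancel_cong[OF assms(1)])
      then have "[b k = c k] (mod int p ^ k)"
        using b c by (meson padic_cong_add cong_sym cong_trans)
      then show "b k = c k" using b c by (simp add: cong_def padic_mod)
    qed
  qed
qed

lemma vector_space_laurent: "vector_space (laurent_scale :: 'k \<Rightarrow> ('n::finite, 'k::field) laurent_op)"
  by unfold_locales
    (simp_all add: laurent_scale_def algebra_simps single_add mult_single single_one flip: mult.assoc)

lemma K_linear_iff:
  "K_linear u \<longleftrightarrow> (\<forall>f g. u (f + g) = u f + u g) \<and>
    (\<forall>c f. u (laurent_scale c f) = laurent_scale c (u f))"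
  by (simp add: Vector_Spaces.linear_iff vector_space_laurent)

lemma diff_ops_linear: "u \<in> diff_ops m \<Longrightarrow> K_linear u"
  by (cases m) auto

lemma zero_diff_ops: "(\<lambda>_. 0) \<in> diff_ops m"
  by (induction m) (auto simp: K_linear_iff laurent_scale_def commutator_def mult_op_def)

lemma diff_ops_Suc: "diff_ops m \<subseteq> diff_ops (Suc m)"
proof (induction m)
  case 0
  have "u \<in> diff_ops (Suc 0)" if u: "u \<in> diff_ops 0" for u :: "('a, 'b) laurent_op"
  proof -
    from u have "K_linear u" "\<And>a. commutator (mult_op a) u = (\<lambda>_. 0)" by simp_all
    then show ?thesis unfolding diff_ops.simps(2) by (simp del: diff_ops.simps add: zero_diff_ops)
  qed
  then show ?case by blast
qed auto

lemma diff_ops_mono: "m \<le> n \<Longrightarrow> diff_ops m \<subseteq> diff_ops n"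
  using diff_ops_Suc by (rule lift_Suc_mono_le)

lemma diff_ops_add: "u \<in> diff_ops m \<Longrightarrow> v \<in> diff_ops m \<Longrightarrow> (\<lambda>f. u f + v f) \<in> diff_ops m"
proof (induction m arbitrary: u v)
  case (Suc m)
  have "commutator (mult_op a) (\<lambda>f. u f + v f) =
      (\<lambda>f. commutator (mult_op a) u f + commutator (mult_op a) v f)" for a
    by (simp add: commutator_def mult_op_def algebra_simps)
  with Suc show ?case by (auto simp: K_linear_iff laurent_scale_def algebra_simps)
qed (auto simp: K_linear_iff laurent_scale_def commutator_def mult_op_def fun_eq_iff algebra_simps)

lemma mult_op_diff_ops: "mult_op a \<in> diff_ops 0"
  by (auto simp: K_linear_iff laurent_scale_def commutator_def mult_op_def algebra_simps)

lemma diff_ops_comp: "u \<in> diff_ops m \<Longrightarrow> v \<in> diff_ops n \<Longrightarrow> u \<circ> v \<in> diff_ops (m + n)"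
proof (induction "m + n" arbitrary: m n u v)
  case 0
  then show ?case
    by (auto simp: K_linear_iff commutator_def mult_op_def fun_eq_iff)
next
  case (Suc l)
  note lin = diff_ops_linear[OF Suc.prems(1)] diff_ops_linear[OF Suc.prems(2)]
  have diff: "u (f - g) = u f - u g" for f g
    using lin(1) unfolding K_linear_iff by (metis add_diff_cancel diff_add_cancel)
  have "commutator (mult_op a) (u \<circ> v) \<in> diff_ops l" for a
  proof -
    have eq: "commutator (mult_op a) (u \<circ> v) =
      (\<lambda>f. (commutator (mult_op a) u \<circ> v) f + (u \<circ> commutator (mult_op a) v) f)"
      by (simp add: commutator_def mult_op_def fun_eq_iff diff)
    have 1: "commutator (mult_op a) u \<circ> v \<in> diff_ops l"
    proof (cases m)
      case 0
      then have "commutator (mult_op a) u \<circ> v = (\<lambda>_. 0)" using Suc.prems by (auto simp: fun_eq_iff)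
      then show ?thesis by (simp only: zero_diff_ops)
    next
      case (Suc m')
      then show ?thesis using Suc.hyps Suc.prems by auto
    qed
    have 2: "u \<circ> commutator (mult_op a) v \<in> diff_ops l"
    proof (cases n)
      case 0
      then have "u \<circ> commutator (mult_op a) v = (\<lambda>_. 0)"
        using Suc.prems diff[of 0 0] by (auto simp: fun_eq_iff)
      then show ?thesis by (simp only: zero_diff_ops)
    next
      case (Suc n')
      then show ?thesis using Suc.hyps Suc.prems by auto
    qed
    show ?thesis unfolding eq using 1 2 by (rule diff_ops_add)
  qed
  moreover have "K_linear (u \<circ> v)" using lin by (simp add: K_linear_iff)
  ultimately show ?case by (simp flip: Suc.hyps(2))
qed

lemma diff_ring_add_mem:
  assumes "u \<in> carrier diff_ring" "v \<in> carrier diff_ring"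
  shows "u \<oplus>\<^bsub>diff_ring\<^esub> v \<in> carrier diff_ring"
proof -
  from assms obtain m n where "u \<in> diff_ops m" "v \<in> diff_ops n" by (auto simp: diff_ring_def)
  then have "u \<in> diff_ops (max m n)" "v \<in> diff_ops (max m n)"
    using diff_ops_mono[of m "max m n"] diff_ops_mono[of n "max m n"] by auto
  then have "(\<lambda>f. u f + v f) \<in> diff_ops (max m n)" by (rule diff_ops_add)
  then show ?thesis by (auto simp: diff_ring_def)
qed

lemma diff_ring_mult_mem:
  "u \<in> carrier diff_ring \<Longrightarrow> v \<in> carrier diff_ring \<Longrightarrow> u \<otimes>\<^bsub>diff_ring\<^esub> v \<in> carrier diff_ring"
  by (auto simp: diff_ring_def dest: diff_ops_comp)

lemma mult_op_mem: "mult_op a \<in> carrier diff_ring"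
  using mult_op_diff_ops by (auto simp: diff_ring_def simp del: diff_ops.simps)

lemma laurent_scale_mem: "laurent_scale c \<in> carrier diff_ring"
  using mult_op_mem[of "Poly_Mapping.single 0 c"] by (simp add: mult_op_def laurent_scale_def[abs_def])

lemma diff_ring_ring: "ring (diff_ring :: ('n::finite, 'k::field) laurent_op ring)"
proof (rule ringI)
  show "abelian_group (diff_ring :: ('n, 'k) laurent_op ring)"
  proof (rule abelian_groupI)
    show "\<zero>\<^bsub>diff_ring\<^esub> \<in> carrier diff_ring" using zero_diff_ops by (auto simp: diff_ring_def)
  next
    fix u :: "('n, 'k) laurent_op" assume u: "u \<in> carrier diff_ring"
    have "mult_op (- 1) \<otimes>\<^bsub>diff_ring\<^esub> u \<in> carrier diff_ring"
      using mult_op_mem u by (rule diff_ring_mult_mem)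
    then show "\<exists>v\<in>carrier diff_ring. v \<oplus>\<^bsub>diff_ring\<^esub> u = \<zero>\<^bsub>diff_ring\<^esub>"
      by (rule rev_bexI) (simp add: diff_ring_def mult_op_def)
  qed (use diff_ring_add_mem in \<open>auto simp: diff_ring_def algebra_simps\<close>)
  show "monoid (diff_ring :: ('n, 'k) laurent_op ring)"
  proof (rule monoidI)
    show "\<one>\<^bsub>diff_ring\<^esub> \<in> carrier diff_ring"
      using mult_op_mem[of 1] by (simp add: diff_ring_def mult_op_def id_def)
  qed (use diff_ring_mult_mem in \<open>auto simp: diff_ring_def\<close>)
next
  fix u v w :: "('n, 'k) laurent_op"
  assume "w \<in> carrier diff_ring"
  then have "K_linear w" using diff_ops_linear by (auto simp: diff_ring_def)
  then show "w \<otimes>\<^bsub>diff_ring\<^esub> (u \<oplus>\<^bsub>diff_ring\<^esub> v) =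
      w \<otimes>\<^bsub>diff_ring\<^esub> u \<oplus>\<^bsub>diff_ring\<^esub> w \<otimes>\<^bsub>diff_ring\<^esub> v"
    by (auto simp: diff_ring_def K_linear_iff)
qed (auto simp: diff_ring_def)

lemma subgroup_diff_aut:
  "subgroup (carrier diff_aut)
     (BijGroup (carrier (diff_ring :: ('n::finite, 'k::field) laurent_op ring)))"
proof -
  let ?D = "diff_ring :: ('n, 'k) laurent_op ring"
  let ?B = "BijGroup (carrier ?D)"
  interpret ring ?D by (rule diff_ring_ring)
  have smult: "laurent_scale c \<circ> u = laurent_scale c \<otimes>\<^bsub>?D\<^esub> u" for c u
    by (simp add: diff_ring_def)
  have car: "\<sigma> \<in> carrier diff_aut \<longleftrightarrow> \<sigma> \<in> Bij (carrier ?D) \<and> \<sigma> \<in> ring_hom ?D ?D \<and>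
    (\<forall>c. \<forall>u\<in>carrier ?D. \<sigma> (laurent_scale c \<otimes>\<^bsub>?D\<^esub> u) = laurent_scale c \<otimes>\<^bsub>?D\<^esub> \<sigma> u)" for \<sigma>
    by (auto simp: diff_aut_def smult)
  note mem = laurent_scale_mem
  show ?thesis
  proof (rule subgroup.intro)
    show "carrier diff_aut \<subseteq> carrier ?B" by (auto simp: car BijGroup_def)
  next
    fix x y :: "('n, 'k) laurent_op \<Rightarrow> ('n, 'k) laurent_op"
    assume xy: "x \<in> carrier diff_aut" "y \<in> carrier diff_aut"
    then have B: "x \<in> Bij (carrier ?D)" "y \<in> Bij (carrier ?D)" by (auto simp: car)
    have y: "y u \<in> carrier ?D" if "u \<in> carrier ?D" for u
      using that B Bij_imp_funcset by blast
    have "compose (carrier ?D) x y \<in> ring_hom ?D ?D"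
      using xy unfolding car by (auto simp: ring_hom_def compose_def y)
    moreover have "compose (carrier ?D) x y (laurent_scale c \<otimes>\<^bsub>?D\<^esub> u) =
        laurent_scale c \<otimes>\<^bsub>?D\<^esub> compose (carrier ?D) x y u" if "u \<in> carrier ?D" for c u
      using xy that unfolding car by (simp add: compose_def y mem)
    ultimately have "compose (carrier ?D) x y \<in> carrier diff_aut"
      unfolding car using compose_Bij[OF B] by blast
    then show "x \<otimes>\<^bsub>?B\<^esub> y \<in> carrier diff_aut" using B by (simp add: BijGroup_def)
  next
    show "\<one>\<^bsub>?B\<^esub> \<in> carrier diff_aut"
      unfolding car by (auto simp: BijGroup_def id_Bij ring_hom_def mem)
  next
    fix x :: "('n, 'k) laurent_op \<Rightarrow> ('n, 'k) laurent_op"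
    assume x: "x \<in> carrier diff_aut"
    then have xB: "x \<in> Bij (carrier ?D)" by (simp add: car)
    have bij: "bij_betw x (carrier ?D) (carrier ?D)" using xB by (simp add: Bij_def)
    let ?y = "inv_into (carrier ?D) x"
    have y: "?y u \<in> carrier ?D" if "u \<in> carrier ?D" for u
      using Bij_inv_into_mem[OF xB that] .
    have xy: "x (?y u) = u" if "u \<in> carrier ?D" for u
      using bij_betw_inv_into_right[OF bij that] .
    have eqI: "?y u = v" if "x v = u" "v \<in> carrier ?D" for u v
      using bij_betw_inv_into_left[OF bij that(2)] that(1) by simp
    have "restrict ?y (carrier ?D) \<in> carrier diff_aut"
      unfolding car
    proof (intro conjI allI ballI)
      show "restrict ?y (carrier ?D) \<in> Bij (carrier ?D)" using xB by (rule restrict_inv_into_Bij)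
      show "restrict ?y (carrier ?D) \<in> ring_hom ?D ?D"
        using x unfolding car
        by (auto simp: ring_hom_def y xy intro!: eqI)
      fix c and u :: "('n, 'k) laurent_op" assume "u \<in> carrier ?D"
      then show "restrict ?y (carrier ?D) (laurent_scale c \<otimes>\<^bsub>?D\<^esub> u) =
          laurent_scale c \<otimes>\<^bsub>?D\<^esub> restrict ?y (carrier ?D) u"
        using x unfolding car by (auto simp: y xy mem intro!: eqI)
    qed
    then show "inv\<^bsub>?B\<^esub> x \<in> carrier diff_aut" by (simp add: inv_BijGroup xB)
  qed
qed

lemma group_diff_aut: "group (diff_aut :: (('n::finite, 'k::field) laurent_op \<Rightarrow> _) monoid)"
proof -
  have "(diff_aut :: (('n, 'k) laurent_op \<Rightarrow> _) monoid) =
      BijGroup (carrier diff_ring)\<lparr>carrier := carrier diff_aut\<rparr>"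
    by (simp add: diff_aut_def)
  then show ?thesis
    using group.subgroup_imp_group[OF group_BijGroup subgroup_diff_aut] by metis
qed

lemma group_st_group: "group (st_group :: (('n::finite, 'k::field) laurent_op \<Rightarrow> _) monoid)"
proof -
  let ?A = "diff_aut :: (('n, 'k) laurent_op \<Rightarrow> _) monoid"
  let ?D = "diff_ring :: ('n, 'k) laurent_op ring"
  let ?S = "{\<sigma> \<in> carrier ?A. \<forall>a. \<sigma> (mult_op a) = mult_op a}"
  interpret A: group ?A by (rule group_diff_aut)
  have B: "x \<in> Bij (carrier ?D)" if "x \<in> carrier ?A" for x
    using that by (auto simp: diff_aut_def)
  have mult: "(x \<otimes>\<^bsub>?A\<^esub> y) (mult_op a) = x (y (mult_op a))" if "x \<in> carrier ?A" "y \<in> carrier ?A" for x y a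
    using B[OF that(1)] B[OF that(2)] by (simp add: diff_aut_def BijGroup_def compose_def mult_op_mem)
  have one: "\<one>\<^bsub>?A\<^esub> (mult_op a) = mult_op a" for a
    by (simp add: diff_aut_def BijGroup_def mult_op_mem)
  have "subgroup ?S ?A"
  proof (rule A.subgroupI)
    show "?S \<noteq> {}" using one A.one_closed by blast
    fix x assume x: "x \<in> ?S"
    have "(inv\<^bsub>?A\<^esub> x) (mult_op a) = mult_op a" for a
    proof -
      have "(inv\<^bsub>?A\<^esub> x) (mult_op a) = (inv\<^bsub>?A\<^esub> x \<otimes>\<^bsub>?A\<^esub> x) (mult_op a)"
        by (subst mult) (use x in auto)
      also have "\<dots> = mult_op a" using x by (simp add: one)
      finally show ?thesis .
    qed
    then show "inv\<^bsub>?A\<^esub> x \<in> ?S" using x by simp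
    fix y assume "y \<in> ?S"
    then show "x \<otimes>\<^bsub>?A\<^esub> y \<in> ?S" using x by (simp add: mult)
  qed auto
  then show ?thesis unfolding st_group_def by (rule A.subgroup_imp_group)
qed

end

theory Submission
  imports Defs "HOL-Number_Theory.Residues"
begin

text \<open>
  Write \<open>L\<close> for the Laurent polynomial ring, \<open>D\<close> for its ring of differential operators and \<open>p\<close> for the
  characteristic of the field. The idea is that \<open>D\<close> is a union of matrix algebras on each of which
  everything becomes finite. In characteristic \<open>p\<close> a differential operator commutes with all
  monomials \<open>x\<^sup>\<gamma>\<close> whose exponents are divisible by a sufficiently high power \<open>q = p ^ k\<close>, and conversely
  every linear operator with this property is a differential operator (\<open>diff_ring_carrier\<close>). Call the
  operators commuting with these monomials the level \<open>q\<close>. It is generated over \<open>L\<close> by one idempotent,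
  the projection \<open>e\<^sub>q\<close> onto the span of the monomials with exponents divisible by \<open>q\<close>
  (\<open>level_ops_subset\<close>).

  Conjugation \<open>u \<mapsto> x\<^sup>-\<^sup>m u x\<^sup>m\<close> by an integral power depends on level \<open>q\<close> only on \<open>m\<close> modulo \<open>q\<close>. Hence
  the residues of a p-adic vector \<open>s\<close> modulo the powers of \<open>p\<close> define a conjugation \<open>x\<^sup>-\<^sup>s u x\<^sup>s\<close> on all
  of \<open>D\<close>, called \<open>padic_conj\<close> below. It is visibly an automorphism fixing \<open>L\<close>, additive in \<open>s\<close>, and
  its value on a divided power \<open>\<partial>\<^sup>[\<^sup>\<alpha>\<^sup>]\<close> is computed on the coefficients, using that the residue of
  \<open>\<beta> choose j\<close> modulo \<open>p\<close> is periodic in \<open>\<beta>\<close> with period \<open>q\<close> as soon as \<open>j < q\<close>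
  (\<open>int_binom_cong\<close>). Since \<open>e\<^sub>q\<close> is \<open>\<partial>\<^sup>[\<^sup>\<alpha>\<^sup>] x\<^sup>\<alpha>\<close> with all \<open>\<alpha>\<^sub>i = q - 1\<close>, \<open>L\<close> and the divided powers
  generate \<open>D\<close>, so \<open>padic_conj\<close> is the only automorphism with the prescribed values.

  The conjugates of \<open>e\<^sub>q\<close> by \<open>x\<^sup>m\<close> project onto different residue classes for different \<open>m\<close> modulo \<open>q\<close>;
  this gives injectivity. For surjectivity let \<open>\<sigma>\<close> be an automorphism fixing \<open>L\<close>. By induction on \<open>k\<close>
  it agrees with a conjugation on level \<open>p ^ k\<close> (\<open>level_ops_conj\<close>). For the step one may assume that
  \<open>\<sigma>\<close> is the identity on level \<open>q = p ^ k\<close>. The next level arises from it by adjoining the diagonal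
  operators \<open>T\<^sub>i\<close> that multiply \<open>x\<^sup>\<beta>\<close> by the integer quotient of \<open>\<beta>\<^sub>i\<close> by \<open>q\<close>. Commutators of \<open>T\<^sub>i\<close> with
  elements of \<open>L\<close> have level \<open>q\<close> and are fixed, so \<open>\<sigma>(T\<^sub>i) - T\<^sub>i\<close> commutes with \<open>L\<close>, which makes it
  multiplication by some \<open>b \<in> L\<close>. The relation \<open>T (T - 1) \<dots> (T - p + 1) = 0\<close> is inherited by
  \<open>T\<^sub>i + b\<close>, and a look at an extremal exponent of \<open>b\<close> shows that \<open>b\<close> is a constant in the prime field
  (\<open>constant_of_falling_product_zero\<close>). Adding a constant \<open>j\<close> to \<open>T\<^sub>i\<close> is what conjugation by
  \<open>x\<^sub>i\<close> to the power \<open>q j\<close> does, and such conjugations are trivial on level \<open>q\<close>.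
\<close>

section \<open>Linear operators on Laurent polynomials\<close>

lemma lookup_single_mult:
  fixes f :: "'a::ab_group_add \<Rightarrow>\<^sub>0 'k::comm_semiring_1"
  shows "Poly_Mapping.lookup (Poly_Mapping.single \<gamma> c * f) \<beta> = c * Poly_Mapping.lookup f (\<beta> - \<gamma>)"
proof -
  have "(\<beta> = l + r) = (\<beta> - l = r)" for l r :: 'a by (auto simp: algebra_simps)
  then show ?thesis by (simp add: lookup_mult lookup_single when_mult)
qed

lemma lookup_mult_keys:
  fixes f g :: "'a::ab_group_add \<Rightarrow>\<^sub>0 'k::comm_semiring_1"
  shows "Poly_Mapping.lookup (f * g) \<beta> =
    (\<Sum>\<gamma>\<in>Poly_Mapping.keys f. Poly_Mapping.lookup f \<gamma> * Poly_Mapping.lookup g (\<beta> - \<gamma>))"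
proof -
  have f: "f = (\<Sum>\<gamma>\<in>Poly_Mapping.keys f. Poly_Mapping.single \<gamma> (Poly_Mapping.lookup f \<gamma>))"
    by (rule poly_mapping_eqI) (simp add: lookup_sum lookup_single when_def in_keys_iff)
  have "f * g = (\<Sum>\<gamma>\<in>Poly_Mapping.keys f. Poly_Mapping.single \<gamma> (Poly_Mapping.lookup f \<gamma>) * g)"
    by (subst f) (simp add: sum_distrib_right)
  then show ?thesis by (simp add: lookup_sum lookup_single_mult)
qed

lemma K_linear_sum: "K_linear u \<Longrightarrow> u (\<Sum>i\<in>A. g i) = (\<Sum>i\<in>A. u (g i))"
proof (induction A rule: infinite_finite_induct)
  case (infinite A)
  then show ?case by (simp add: K_linear_iff) (metis add_cancel_right_right)
next
  case empty
  then show ?case by (simp add: K_linear_iff) (metis add_cancel_right_right)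
qed (auto simp: K_linear_iff)

lemma K_linear_eqI:
  fixes u v :: "('n::finite, 'k::field) laurent_op"
  assumes "K_linear u" "K_linear v"
    and "\<And>\<beta>. u (Poly_Mapping.single \<beta> 1) = v (Poly_Mapping.single \<beta> 1)"
  shows "u = v"
proof
  fix f :: "('n, 'k) laurent"
  have f: "f = (\<Sum>\<gamma>\<in>Poly_Mapping.keys f.
      laurent_scale (Poly_Mapping.lookup f \<gamma>) (Poly_Mapping.single \<gamma> 1))"
    by (rule poly_mapping_eqI)
      (simp add: lookup_sum lookup_single when_def in_keys_iff laurent_scale_def mult_single)
  have "u (laurent_scale c (Poly_Mapping.single \<beta> 1)) = v (laurent_scale c (Poly_Mapping.single \<beta> 1))" for c \<beta>
    using assms by (simp add: K_linear_iff)
  then show "u f = v f"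
    by (subst (1 2) f) (simp add: K_linear_sum assms)
qed

lemma K_linear_mult_op: "K_linear (mult_op a)"
  using mult_op_diff_ops diff_ops_linear by blast

lemma K_linear_comp: "K_linear u \<Longrightarrow> K_linear v \<Longrightarrow> K_linear (u \<circ> v)"
  by (simp add: K_linear_iff)

lemma K_linear_add: "K_linear u \<Longrightarrow> K_linear v \<Longrightarrow> K_linear (\<lambda>f. u f + v f)"
  by (simp add: K_linear_iff laurent_scale_def algebra_simps)

lemma lookup_laurent_scale: "Poly_Mapping.lookup (laurent_scale c f) \<beta> = c * Poly_Mapping.lookup f \<beta>"
  by (simp add: laurent_scale_def lookup_single_mult)

lemma K_linear_commutator: "K_linear u \<Longrightarrow> K_linear v \<Longrightarrow> K_linear (commutator u v)"
  by (simp add: K_linear_iff commutator_def laurent_scale_def right_diff_distrib)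

lemma lookup_monomial_op:
  fixes c :: "int ^ 'n::finite \<Rightarrow> 'k::field"
  shows "Poly_Mapping.lookup (monomial_op \<alpha> c f) \<beta> =
    c (\<beta> + (\<chi> i. int (\<alpha> $ i))) * Poly_Mapping.lookup f (\<beta> + (\<chi> i. int (\<alpha> $ i)))"
proof -
  have "(\<gamma> - a = \<beta>) = (\<gamma> = \<beta> + a)" for \<gamma> \<beta> a :: "int ^ 'n" by (auto simp: algebra_simps)
  then show ?thesis
    by (simp add: monomial_op_def lookup_sum lookup_single when_def in_keys_iff)
qed

lemma K_linear_monomial_op: "K_linear (monomial_op \<alpha> c)"
  unfolding K_linear_iff laurent_scale_def
  by (auto intro!: poly_mapping_eqI simp: lookup_monomial_op lookup_add lookup_single_mult ring_distribs)

definition diag_op :: "(int ^ 'n \<Rightarrow> 'k) \<Rightarrow> ('n::finite, 'k::field) laurent_op" where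
  "diag_op c = monomial_op 0 c"

lemma lookup_diag_op:
  fixes c :: "int ^ 'n::finite \<Rightarrow> 'k::field"
  shows "Poly_Mapping.lookup (diag_op c f) \<beta> = c \<beta> * Poly_Mapping.lookup f \<beta>"
proof -
  have "\<beta> + (\<chi> i. int ((0 :: nat ^ 'n) $ i)) = \<beta>" by (simp add: vec_eq_iff)
  then show ?thesis by (simp add: diag_op_def lookup_monomial_op)
qed

lemma K_linear_diag_op: "K_linear (diag_op c)"
  by (simp add: diag_op_def K_linear_monomial_op)

lemma diag_op_single: "diag_op c (Poly_Mapping.single \<beta> k) = Poly_Mapping.single \<beta> (c \<beta> * k)"
  by (rule poly_mapping_eqI) (auto simp: lookup_diag_op lookup_single when_def)

lemma diag_op_mult: "diag_op (\<lambda>\<beta>. c \<beta> * d \<beta>) = diag_op c \<circ> diag_op d"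
  by (rule ext, rule poly_mapping_eqI) (simp add: lookup_diag_op)

lemma diag_op_add: "diag_op (\<lambda>\<beta>. c \<beta> + d \<beta>) = (\<lambda>f. diag_op c f + diag_op d f)"
  by (rule ext, rule poly_mapping_eqI) (simp add: lookup_diag_op lookup_add algebra_simps)

lemma diag_op_const: "diag_op (\<lambda>\<beta>. k) = mult_op (Poly_Mapping.single 0 k)"
  by (rule ext, rule poly_mapping_eqI) (simp add: lookup_diag_op mult_op_def lookup_single_mult)

section \<open>The filtration of the differential operators by levels\<close>

definition op_subalgebra :: "('n::finite, 'k::field) laurent_op set \<Rightarrow> bool" where
  "op_subalgebra S \<longleftrightarrow> (\<forall>a. mult_op a \<in> S) \<and> (\<forall>u\<in>S. \<forall>v\<in>S. u \<circ> v \<in> S \<and> (\<lambda>f. u f + v f) \<in> S)"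

lemma op_subalgebra_diff_ring:
  "op_subalgebra (carrier (diff_ring :: ('n::finite, 'k::field) laurent_op ring))"
proof -
  have "u \<circ> v \<in> carrier diff_ring \<and> (\<lambda>f. u f + v f) \<in> carrier diff_ring"
    if "u \<in> carrier diff_ring" "v \<in> carrier diff_ring" for u v :: "('n, 'k) laurent_op"
    using diff_ring_mult_mem[OF that] diff_ring_add_mem[OF that]
    by (simp add: diff_ring_def del: diff_ops.simps)
  then show ?thesis by (simp add: op_subalgebra_def mult_op_mem)
qed

text \<open>
  These are the endomorphisms of \<open>L\<close> over the subring of Laurent polynomials in the \<open>q\<close>-th powers of
  the variables. For \<open>q > 0\<close>, as \<open>L\<close> is free of rank \<open>q ^ n\<close> over this subring, they form a matrix algebra.
\<close>

definition level_ops :: "nat \<Rightarrow> ('n::finite, 'k::field) laurent_op set" where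
  "level_ops q = {u. K_linear u \<and> (\<forall>\<gamma> f. (\<forall>i. int q dvd \<gamma> $ i) \<longrightarrow>
     u (Poly_Mapping.single \<gamma> 1 * f) = Poly_Mapping.single \<gamma> 1 * u f)}"

lemma level_opsD:
  "u \<in> level_ops q \<Longrightarrow> (\<And>i. int q dvd \<gamma> $ i) \<Longrightarrow>
    u (Poly_Mapping.single \<gamma> 1 * f) = Poly_Mapping.single \<gamma> 1 * u f"
  by (simp add: level_ops_def)

lemma op_subalgebra_level_ops: "op_subalgebra (level_ops q)"
  unfolding op_subalgebra_def level_ops_def
  using K_linear_mult_op K_linear_comp K_linear_add
  by (auto simp: mult_op_def algebra_simps)

lemma level_ops_mono: "q dvd r \<Longrightarrow> level_ops q \<subseteq> level_ops r"
  unfolding level_ops_def using dvd_trans[of "int q" "int r"] by auto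

lemma diag_op_level:
  assumes "\<And>\<beta> \<gamma>. (\<And>i. int q dvd \<gamma> $ i) \<Longrightarrow> c (\<beta> + \<gamma>) = c \<beta>"
  shows "diag_op c \<in> level_ops q"
proof -
  have "diag_op c (Poly_Mapping.single \<gamma> 1 * f) = Poly_Mapping.single \<gamma> 1 * diag_op c f"
    if "\<forall>i. int q dvd \<gamma> $ i" for \<gamma> f
  proof (rule poly_mapping_eqI)
    fix \<beta>
    have "c \<beta> = c (\<beta> - \<gamma>)" using assms[of \<gamma> "\<beta> - \<gamma>"] that by simp
    then show "Poly_Mapping.lookup (diag_op c (Poly_Mapping.single \<gamma> 1 * f)) \<beta> =
        Poly_Mapping.lookup (Poly_Mapping.single \<gamma> 1 * diag_op c f) \<beta>"
      by (simp add: lookup_diag_op lookup_single_mult)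
  qed
  then show ?thesis by (simp add: level_ops_def K_linear_diag_op)
qed

definition conj_op :: "int ^ 'n \<Rightarrow> ('n::finite, 'k::field) laurent_op \<Rightarrow> ('n, 'k) laurent_op" where
  "conj_op m u f = Poly_Mapping.single (- m) 1 * u (Poly_Mapping.single m 1 * f)"

lemma single_mult_assoc:
  "Poly_Mapping.single m 1 * (Poly_Mapping.single n 1 * f) =
    Poly_Mapping.single (m + n) 1 * f"
  for f :: "'a::comm_monoid_add \<Rightarrow>\<^sub>0 'k::comm_semiring_1"
  by (simp add: mult_single flip: mult.assoc)

lemma conj_op_conj_op: "conj_op m (conj_op n u) = conj_op (m + n) u"
  by (rule ext) (simp add: conj_op_def single_mult_assoc add.commute)

lemma conj_op_zero: "conj_op 0 u = u"
  by (rule ext) (simp add: conj_op_def)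

lemma conj_op_comp: "conj_op m (u \<circ> v) = conj_op m u \<circ> conj_op m v"
  by (rule ext) (simp add: conj_op_def single_mult_assoc)

lemma conj_op_add: "conj_op m (\<lambda>f. u f + v f) = (\<lambda>f. conj_op m u f + conj_op m v f)"
  by (rule ext) (simp add: conj_op_def algebra_simps)

lemma conj_op_mult_op: "conj_op m (mult_op a) = mult_op a"
proof
  fix f
  have "conj_op m (mult_op a) f = Poly_Mapping.single (- m) 1 * (Poly_Mapping.single m 1 * (a * f))"
    by (simp add: conj_op_def mult_op_def ac_simps)
  then show "conj_op m (mult_op a) f = mult_op a f" by (simp add: single_mult_assoc mult_op_def)
qed

lemma conj_op_eq_comp:
  "conj_op m u = mult_op (Poly_Mapping.single (- m) 1) \<circ> (u \<circ> mult_op (Poly_Mapping.single m 1))"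
  by (rule ext) (simp add: conj_op_def mult_op_def)

lemma conj_op_mem: "op_subalgebra S \<Longrightarrow> u \<in> S \<Longrightarrow> conj_op m u \<in> S"
  by (simp add: conj_op_eq_comp op_subalgebra_def)

text \<open>
  The power \<open>x\<^sup>m\<^sup>-\<^sup>n\<close> has exponents divisible by \<open>q\<close> and so passes through \<open>u\<close>. This is what allows
  conjugation by powers with p-adic exponents.
\<close>

lemma conj_op_cong:
  assumes u: "u \<in> level_ops q" and mn: "\<And>i. [m $ i = n $ i] (mod int q)"
  shows "conj_op m u = conj_op n u"
proof
  fix f
  have d: "int q dvd (m - n) $ i" for i using mn[of i] by (simp add: cong_iff_dvd_diff)
  have "u (Poly_Mapping.single m 1 * f) = u (Poly_Mapping.single (m - n) 1 * (Poly_Mapping.single n 1 * f))"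
    by (simp add: single_mult_assoc)
  also have "\<dots> = Poly_Mapping.single (m - n) 1 * u (Poly_Mapping.single n 1 * f)"
    by (rule level_opsD[OF u d])
  finally show "conj_op m u f = conj_op n u f" by (simp add: conj_op_def single_mult_assoc)
qed

lemma conj_op_monomial_op: "conj_op m (monomial_op \<alpha> c) = monomial_op \<alpha> (\<lambda>\<beta>. c (\<beta> + m))"
  by (rule ext, rule poly_mapping_eqI)
    (simp add: conj_op_def lookup_monomial_op lookup_single_mult add_ac)

lemma conj_op_diag_op: "conj_op m (diag_op c) = diag_op (\<lambda>\<beta>. c (\<beta> + m))"
  by (simp add: diag_op_def conj_op_monomial_op)

definition residue_proj :: "nat \<Rightarrow> ('n::finite, 'k::field) laurent_op" where
  "residue_proj q = diag_op (\<lambda>\<beta>. if \<forall>i. int q dvd \<beta> $ i then 1 else 0)"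

lemma residue_proj_level: "residue_proj q \<in> level_ops q"
  unfolding residue_proj_def by (rule diag_op_level) (simp add: dvd_add_left_iff)

text \<open>
  An operator commuting with the monomials whose exponents are divisible by \<open>q\<close> is determined by its
  values on the monomials \<open>x\<^sup>\<gamma>\<close> with \<open>0 \<le> \<gamma>\<^sub>i < q\<close>; explicitly it is the sum of the operators
  \<open>u(x\<^sup>\<gamma>) e\<^sub>q x\<^sup>-\<^sup>\<gamma>\<close> over these \<open>\<gamma>\<close>. The conditions on \<open>S\<close> are chosen so as to
  be satisfied by the differential operators of bounded order as well as by subalgebras.
\<close>

lemma level_ops_subset:
  fixes S :: "('n::finite, 'k::field) laurent_op set"
  assumes q: "q > 0"
    and gen: "\<And>a b. mult_op a \<circ> (residue_proj q \<circ> mult_op b) \<in> S"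
    and add: "\<And>u v. u \<in> S \<Longrightarrow> v \<in> S \<Longrightarrow> (\<lambda>f. u f + v f) \<in> S"
  shows "level_ops q \<subseteq> S"
proof
  fix u :: "('n, 'k) laurent_op" assume u: "u \<in> level_ops q"
  then have lin: "K_linear u" by (simp add: level_ops_def)
  let ?x = "\<lambda>\<gamma>. Poly_Mapping.single \<gamma> 1 :: ('n, 'k) laurent"
  define B where "B = {\<gamma> :: int ^ 'n. \<forall>i. \<gamma> $ i \<in> {0..<int q}}"
  have "B \<subseteq> (\<lambda>g. \<chi> i. g i) ` (\<Pi>\<^sub>E i\<in>UNIV. {0..<int q})"
  proof
    fix \<gamma> assume "\<gamma> \<in> B"
    then show "\<gamma> \<in> (\<lambda>g. \<chi> i. g i) ` (\<Pi>\<^sub>E i\<in>UNIV. {0..<int q})"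
      by (intro image_eqI[of _ _ "\<lambda>i. \<gamma> $ i"]) (auto simp: B_def)
  qed
  then have finB: "finite B" by (rule finite_subset) (simp add: finite_PiE)
  define w where "w = (\<lambda>\<gamma>. mult_op (u (?x \<gamma>)) \<circ> (residue_proj q \<circ> mult_op (?x (- \<gamma>))))"
  have sumS: "(\<lambda>f. \<Sum>\<gamma>\<in>A. w \<gamma> f) \<in> S" if "finite A" for A
    using that
  proof induction
    case empty
    have "mult_op 0 \<circ> (residue_proj q \<circ> mult_op 0) = (\<lambda>_. 0 :: ('n, 'k) laurent)"
      by (simp add: mult_op_def fun_eq_iff)
    then show ?case using gen[of 0 0] by simp
  next
    case (insert \<gamma> A)
    have "w \<gamma> \<in> S" unfolding w_def by (rule gen)
    from add[OF this insert.IH] have "(\<lambda>f. w \<gamma> f + (\<Sum>\<gamma>\<in>A. w \<gamma> f)) \<in> S" .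
    then show ?case using insert by simp
  qed
  have linw: "K_linear (w \<gamma>)" for \<gamma>
    unfolding w_def residue_proj_def by (intro K_linear_comp K_linear_mult_op K_linear_diag_op)
  have "u = (\<lambda>f. \<Sum>\<gamma>\<in>B. w \<gamma> f)"
  proof (rule K_linear_eqI[OF lin])
    show "K_linear (\<lambda>f. \<Sum>\<gamma>\<in>B. w \<gamma> f)"
      using linw by (simp add: K_linear_iff sum.distrib laurent_scale_def sum_distrib_left)
    fix \<beta>
    define \<gamma>0 :: "int ^ 'n" where "\<gamma>0 = (\<chi> i. \<beta> $ i mod int q)"
    have \<gamma>0: "\<gamma>0 \<in> B" using q by (simp add: B_def \<gamma>0_def)
    have dv: "(\<forall>i. int q dvd (\<beta> - \<gamma>) $ i) \<longleftrightarrow> \<gamma> = \<gamma>0" if "\<gamma> \<in> B" for \<gamma>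
    proof -
      have "int q dvd \<beta> $ i - \<gamma> $ i \<longleftrightarrow> \<beta> $ i mod int q = \<gamma> $ i" for i
        using that by (auto simp: B_def mod_eq_dvd_iff[symmetric])
      then show ?thesis by (auto simp: vec_eq_iff \<gamma>0_def)
    qed
    have "w \<gamma> (?x \<beta>) = (if \<gamma> = \<gamma>0 then u (?x \<gamma>) * ?x (\<beta> - \<gamma>) else 0)" if "\<gamma> \<in> B" for \<gamma>
      using dv[OF that] by (simp add: w_def mult_op_def mult_single residue_proj_def diag_op_single)
    then have "(\<Sum>\<gamma>\<in>B. w \<gamma> (?x \<beta>)) = (\<Sum>\<gamma>\<in>B. if \<gamma> = \<gamma>0 then u (?x \<gamma>) * ?x (\<beta> - \<gamma>) else 0)"
      by (intro sum.cong) auto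
    also have "\<dots> = ?x (\<beta> - \<gamma>0) * u (?x \<gamma>0)" using finB \<gamma>0 by (simp add: mult.commute)
    also have "\<dots> = u (?x (\<beta> - \<gamma>0) * ?x \<gamma>0)"
      using dv[OF \<gamma>0] by (intro level_opsD[OF u, symmetric]) auto
    finally show "u (?x \<beta>) = (\<Sum>\<gamma>\<in>B. w \<gamma> (?x \<beta>))" by (simp add: mult_single)
  qed
  with sumS[OF finB] show "u \<in> S" by simp
qed

lemma level_ops_subset_subalgebra:
  assumes "q > 0" "op_subalgebra S" "residue_proj q \<in> S"
  shows "level_ops q \<subseteq> S"
  using assms by (intro level_ops_subset) (auto simp: op_subalgebra_def)

text \<open>
  For \<open>q = p ^ k\<close> the scalar is the \<open>k\<close>-th digit of \<open>\<beta> $ i\<close> in base \<open>p\<close>, because it only matters modulo the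
  characteristic. By Lucas' theorem this operator is \<open>x\<^sub>i\<^sup>q \<partial>\<^sub>i\<^sup>[\<^sup>q\<^sup>]\<close>.
\<close>

definition digit_op :: "nat \<Rightarrow> 'n \<Rightarrow> ('n::finite, 'k::field) laurent_op" where
  "digit_op q i = diag_op (\<lambda>\<beta>. of_int (\<beta> $ i div int q))"

lemma of_int_power_CHAR_minus_1:
  assumes "prime CHAR('k::field)"
  shows "(of_int t :: 'k) ^ (CHAR('k) - 1) = (if int CHAR('k) dvd t then 0 else 1)"
proof (cases "int CHAR('k) dvd t")
  case True
  then have "(of_int t :: 'k) = 0" by (simp add: of_int_eq_0_iff_char_dvd)
  then show ?thesis using True prime_gt_1_nat[OF assms] by simp
next
  case False
  define a where "a = nat (t mod int CHAR('k))"
  have p: "CHAR('k) > 0" using prime_gt_0_nat[OF assms] .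
  then have a: "int a = t mod int CHAR('k)" by (simp add: a_def)
  then have "\<not> CHAR('k) dvd a" using False p
    by (metis dvd_mod_iff int_dvd_int_iff dvd_refl)
  then have "[a ^ (CHAR('k) - 1) = 1] (mod CHAR('k))" by (rule fermat_theorem[OF assms])
  then have "(of_nat (a ^ (CHAR('k) - 1)) :: 'k) = of_nat 1" by (simp only: of_nat_eq_iff_cong_CHAR)
  moreover have "(of_nat a :: 'k) = of_int t"
  proof -
    have "(of_int (int a) :: 'k) = of_int t"
      unfolding of_int_eq_iff_cong_CHAR a by (simp add: cong_def)
    then show ?thesis by simp
  qed
  ultimately show ?thesis using False by simp
qed

text \<open>
  By Fermat's little theorem \<open>1 - t ^ (p - 1)\<close> is the indicator of \<open>p dvd t\<close>. Hence \<open>e\<^sub>p\<^sub>q\<close> is the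
  product of \<open>e\<^sub>q\<close> and the operators \<open>1 - T\<^sub>i ^ (p - 1)\<close>.
\<close>

lemma residue_proj_mult:
  fixes S :: "('n::finite, 'k::field) laurent_op set"
  assumes "prime CHAR('k)" "q > 0" and S: "op_subalgebra S" "residue_proj q \<in> S" "\<And>i. digit_op q i \<in> S"
  shows "residue_proj (CHAR('k) * q) \<in> S"
proof -
  let ?p = "CHAR('k)"
  have mult: "diag_op (\<lambda>\<beta>. c \<beta> * d \<beta>) \<in> S" if "diag_op c \<in> S" "diag_op d \<in> S" for c d
    using S that unfolding diag_op_mult by (simp add: op_subalgebra_def)
  have add: "diag_op (\<lambda>\<beta>. c \<beta> + d \<beta>) \<in> S" if "diag_op c \<in> S" "diag_op d \<in> S" for c d
    using S that unfolding diag_op_add by (simp add: op_subalgebra_def)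
  have const: "diag_op (\<lambda>\<beta>. k) \<in> S" for k
    using S unfolding diag_op_const by (simp add: op_subalgebra_def)
  have power: "diag_op (\<lambda>\<beta>. c \<beta> ^ N) \<in> S" if "diag_op c \<in> S" for c N
    by (induction N) (auto intro: const mult that)
  have prod: "diag_op (\<lambda>\<beta>. \<Prod>i\<in>A. c i \<beta>) \<in> S" if "finite A" "\<And>i. diag_op (c i) \<in> S" for c and A :: "'n set"
    using that(1) by induction (auto intro: const mult that)
  let ?g = "\<lambda>i \<beta>. 1 + (-1) * (of_int (\<beta> $ i div int q) :: 'k) ^ (?p - 1)"
  have "diag_op (?g i) \<in> S" for i
    by (intro add const mult power S(3)[unfolded digit_op_def])
  then have "diag_op (\<lambda>\<beta>. (if \<forall>i. int q dvd \<beta> $ i then 1 else 0) * (\<Prod>i\<in>UNIV. ?g i \<beta>)) \<in> S"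
    by (intro mult S(2)[unfolded residue_proj_def] prod) auto
  moreover have "(if \<forall>i. int q dvd \<beta> $ i then 1 else 0) * (\<Prod>i\<in>UNIV. ?g i \<beta>) =
    (if \<forall>i. int (?p * q) dvd \<beta> $ i then 1 else 0)" for \<beta> :: "int ^ 'n"
  proof -
    have d: "int (?p * q) dvd x \<longleftrightarrow> int q dvd x \<and> int ?p dvd x div int q" for x
      using assms(2) by (auto elim!: dvdE simp: mult.commute mult.left_commute)
    have "?g i \<beta> = (if int ?p dvd \<beta> $ i div int q then 1 else 0)" for i
      unfolding of_int_power_CHAR_minus_1[OF assms(1)] by simp
    then show ?thesis by (auto simp only: d) (auto intro!: prod.neutral)
  qed
  ultimately show ?thesis by (simp add: residue_proj_def)
qed

text \<open>
  Adding a multiple of \<open>q\<close> to \<open>\<beta> $ i\<close> changes its quotient by an integer that does not depend on \<open>\<beta>\<close>.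
  So for \<open>\<gamma>\<close> divisible by \<open>q\<close>, the digit operator \<open>T\<close> satisfies \<open>T x\<^sup>\<gamma> = x\<^sup>\<gamma> (T + k)\<close> with a constant \<open>k\<close>,
  and this constant cancels in the commutator of \<open>T\<close> with an element of \<open>L\<close>.
\<close>

lemma commutator_digit_op:
  fixes a :: "('n::finite, 'k::field) laurent"
  assumes q: "q > 0"
  shows "commutator (mult_op a) (digit_op q i) \<in> level_ops q"
proof -
  have lin: "K_linear (commutator (mult_op a) (digit_op q i))"
    unfolding digit_op_def by (intro K_linear_commutator K_linear_mult_op K_linear_diag_op)
  moreover have "commutator (mult_op a) (digit_op q i) (Poly_Mapping.single \<gamma> 1 * f) =
      Poly_Mapping.single \<gamma> 1 * commutator (mult_op a) (digit_op q i) f"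
    if \<gamma>: "\<forall>i. int q dvd \<gamma> $ i" for \<gamma> f
  proof -
    let ?k = "of_int (\<gamma> $ i div int q)"
    obtain z where z: "\<gamma> $ i = int q * z" using \<gamma> by (metis dvdE)
    have t: "of_int ((\<beta> $ i - \<gamma> $ i) div int q) = (of_int (\<beta> $ i div int q) - ?k :: 'k)" for \<beta>
    proof -
      have "\<beta> $ i - \<gamma> $ i = \<beta> $ i + int q * (- z)" by (simp add: z)
      then have "(\<beta> $ i - \<gamma> $ i) div int q = - z + \<beta> $ i div int q"
        using q by (simp only: div_mult_self2)
      then show ?thesis using q by (simp add: z)
    qed
    have D: "digit_op q i (Poly_Mapping.single \<gamma> 1 * g) =
        Poly_Mapping.single \<gamma> 1 * digit_op q i g + laurent_scale ?k (Poly_Mapping.single \<gamma> 1 * g)" for g :: "('n, 'k) laurent"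
      by (intro poly_mapping_eqI)
        (simp add: digit_op_def lookup_diag_op lookup_single_mult lookup_add lookup_laurent_scale
          t left_diff_distrib)
    have "a * digit_op q i (Poly_Mapping.single \<gamma> 1 * f) - digit_op q i (Poly_Mapping.single \<gamma> 1 * (a * f)) =
      Poly_Mapping.single \<gamma> 1 * (a * digit_op q i f - digit_op q i (a * f))"
      unfolding D by (simp add: algebra_simps laurent_scale_def)
    then show ?thesis by (simp add: commutator_def mult_op_def algebra_simps)
  qed
  ultimately show ?thesis by (simp add: level_ops_def)
qed

lemma digit_op_level: "q > 0 \<Longrightarrow> digit_op q i \<in> (level_ops (CHAR('k) * q) :: ('n::finite, 'k::field) laurent_op set)"
  unfolding digit_op_def
proof (rule diag_op_level)
  fix \<beta> \<gamma> :: "int ^ 'n"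
  assume q: "q > 0" and "\<And>i. int (CHAR('k) * q) dvd \<gamma> $ i"
  then obtain z where z: "\<gamma> $ i = int (CHAR('k) * q) * z" by (metis dvdE)
  have "(\<beta> + \<gamma>) $ i = \<beta> $ i + int q * (int CHAR('k) * z)" by (simp add: z)
  then have "(\<beta> + \<gamma>) $ i div int q = int CHAR('k) * z + \<beta> $ i div int q"
    using q by (simp only: div_mult_self2)
  then show "(of_int ((\<beta> + \<gamma>) $ i div int q) :: 'k) = of_int (\<beta> $ i div int q)"
    by (simp add: of_int_eq_iff_cong_CHAR cong_def)
qed

lemma level_ops_one: "level_ops 1 = range (mult_op :: ('a::finite, 'b::field) laurent \<Rightarrow> _)"
proof
  have proj: "residue_proj 1 = (id :: ('a, 'b) laurent_op)"
    by (rule ext, rule poly_mapping_eqI) (simp add: residue_proj_def lookup_diag_op)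
  show "level_ops 1 \<subseteq> range (mult_op :: ('a, 'b) laurent \<Rightarrow> _)"
  proof (rule level_ops_subset)
    fix a b :: "('a, 'b) laurent"
    have "mult_op a \<circ> (residue_proj 1 \<circ> mult_op b) = mult_op (a * b)"
      unfolding proj by (simp add: mult_op_def fun_eq_iff mult.assoc)
    then show "mult_op a \<circ> (residue_proj 1 \<circ> mult_op b) \<in> range mult_op" by (simp only: rangeI)
  next
    fix u v :: "('a, 'b) laurent_op" assume "u \<in> range mult_op" "v \<in> range mult_op"
    then obtain a b where "u = mult_op a" "v = mult_op b" by blast
    then have "(\<lambda>f. u f + v f) = mult_op (a + b)"
      by (simp add: mult_op_def fun_eq_iff distrib_right)
    then show "(\<lambda>f. u f + v f) \<in> range mult_op" by (simp only: rangeI)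
  qed simp
qed (use op_subalgebra_level_ops in \<open>auto simp: op_subalgebra_def\<close>)

text \<open>
  The digit operators have order at most one more than the operators of level \<open>q\<close>, as their
  commutators with elements of \<open>L\<close> lie in that level. A bound \<open>m\<close> common to the whole level is
  therefore essential for the induction, and it exists because \<open>e\<^sub>q\<close> generates the level over \<open>L\<close>, whose
  elements have order \<open>0\<close>.
\<close>

lemma level_ops_diff_ops:
  assumes "prime CHAR('k::field)"
  shows "\<exists>m. (level_ops (CHAR('k) ^ k) :: ('n::finite, 'k) laurent_op set) \<subseteq> diff_ops m"
proof (induction k)
  case 0
  have "(level_ops (CHAR('k) ^ 0) :: ('n, 'k) laurent_op set) \<subseteq> diff_ops 0"
    unfolding power_0 level_ops_one using mult_op_diff_ops by blast
  then show ?case by blast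
next
  case (Suc k)
  let ?q = "CHAR('k) ^ k"
  from Suc obtain m where m: "(level_ops ?q :: ('n, 'k) laurent_op set) \<subseteq> diff_ops m" by blast
  have q: "?q > 0" using prime_gt_0_nat[OF assms] by simp
  have digit: "digit_op ?q i \<in> (diff_ops (Suc m) :: ('n, 'k) laurent_op set)" for i
    using m commutator_digit_op[OF q] K_linear_diag_op by (auto simp: digit_op_def)
  have "(residue_proj (CHAR('k) * ?q) :: ('n, 'k) laurent_op) \<in> carrier diff_ring"
  proof (rule residue_proj_mult[OF assms q op_subalgebra_diff_ring])
    show "(residue_proj ?q :: ('n, 'k) laurent_op) \<in> carrier diff_ring"
      using m residue_proj_level by (auto simp: diff_ring_def simp del: diff_ops.simps)
    show "(digit_op ?q i :: ('n, 'k) laurent_op) \<in> carrier diff_ring" for i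
      using digit by (auto simp: diff_ring_def simp del: diff_ops.simps)
  qed
  then obtain r where r: "(residue_proj (CHAR('k) * ?q) :: ('n, 'k) laurent_op) \<in> diff_ops r"
    by (auto simp: diff_ring_def)
  have "(level_ops (CHAR('k) * ?q) :: ('n, 'k) laurent_op set) \<subseteq> diff_ops (0 + (r + 0))"
    using q prime_gt_0_nat[OF assms] r
    by (intro level_ops_subset diff_ops_comp mult_op_diff_ops diff_ops_add) auto
  then show ?case by auto
qed

text \<open>
  Let \<open>u\<close> have order at most \<open>m + 1\<close>, and let \<open>a = x\<^sup>\<delta>\<close> with \<open>\<delta>\<close> divisible by \<open>p ^ m\<close>. The commutator \<open>v = [a, u]\<close> has order at most
  \<open>m\<close>, so it commutes with \<open>a\<close> by induction. Then \<open>u a\<^sup>j = a\<^sup>j u - j a\<^sup>j\<^sup>-\<^sup>1 v\<close> for all \<open>j\<close>, and the last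
  term vanishes for \<open>j = p\<close>.
\<close>

lemma diff_ops_level_ops:
  fixes u :: "('n::finite, 'k::field) laurent_op"
  assumes "prime CHAR('k)"
  shows "u \<in> diff_ops m \<Longrightarrow> u \<in> level_ops (CHAR('k) ^ m)"
proof (induction m arbitrary: u)
  case 0
  then show ?case
    by (auto simp: level_ops_def commutator_def mult_op_def fun_eq_iff)
next
  case (Suc m)
  let ?p = "CHAR('k)"
  have "u (Poly_Mapping.single \<gamma> 1 * f) = Poly_Mapping.single \<gamma> 1 * u f"
    if \<gamma>: "\<forall>i. int (?p ^ Suc m) dvd \<gamma> $ i" for \<gamma> f
  proof -
    define \<delta> where "\<delta> = (\<chi> i. \<gamma> $ i div int ?p)"
    define a :: "('n, 'k) laurent" where "a = Poly_Mapping.single \<delta> 1"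
    define v where "v = commutator (mult_op a) u"
    have p: "int ?p \<noteq> 0" using prime_gt_0_nat[OF assms] by simp
    have \<delta>: "int (?p ^ m) dvd \<delta> $ i" "\<gamma> $ i = int ?p * \<delta> $ i" for i
      using \<gamma>[rule_format, of i] p by (auto simp: \<delta>_def elim!: dvdE)
    have "v \<in> level_ops (?p ^ m)" unfolding v_def using Suc by simp
    then have va: "v (a * g) = a * v g" for g
      unfolding a_def using \<delta>(1) by (rule level_opsD)
    have ua: "u (a * g) = a * u g - v g" for g
      by (simp add: v_def commutator_def mult_op_def)
    have step: "u (a ^ Suc j * f) = a ^ Suc j * u f - of_nat (Suc j) * a ^ j * v f" for j
    proof (induction j)
      case (Suc j)
      have vj: "v (a ^ i * f) = a ^ i * v f" for i by (induction i) (auto simp: va mult.assoc)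
      have "u (a ^ Suc (Suc j) * f) = a * u (a ^ Suc j * f) - v (a ^ Suc j * f)"
        using ua[of "a ^ Suc j * f"] by (simp add: mult.assoc)
      also have "\<dots> = a ^ Suc (Suc j) * u f - of_nat (Suc (Suc j)) * a ^ Suc j * v f"
        unfolding Suc.IH vj by (simp add: algebra_simps)
      finally show ?case .
    qed (simp add: ua)
    obtain j where j: "?p = Suc j" using p by (cases ?p) auto
    have "(of_nat ?p :: ('n, 'k) laurent) = Poly_Mapping.single 0 (of_nat ?p)"
      by (simp only: single_of_nat)
    then have zero: "(of_nat (Suc j) :: ('n, 'k) laurent) = 0" unfolding j[symmetric] by simp
    have "a ^ i = Poly_Mapping.single (\<chi> l. int i * \<delta> $ l) 1" for i
      by (induction i) (auto simp: a_def mult_single vec_eq_iff algebra_simps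
            intro!: arg_cong[where f = "\<lambda>x. Poly_Mapping.single x 1"] simp flip: single_one zero_vec_def)
    then have "a ^ ?p = Poly_Mapping.single \<gamma> 1"
      using \<delta>(2) by (auto simp: vec_eq_iff intro!: arg_cong[where f = "\<lambda>x. Poly_Mapping.single x 1"])
    then show ?thesis using step[of j] unfolding zero j by simp
  qed
  moreover have "K_linear u" using Suc.prems by simp
  ultimately show ?case by (simp add: level_ops_def)
qed

lemma diff_ring_carrier:
  assumes "prime CHAR('k::field)"
  shows "carrier diff_ring = (\<Union>k. (level_ops (CHAR('k) ^ k) :: ('n::finite, 'k) laurent_op set))"
  using level_ops_diff_ops[OF assms] diff_ops_level_ops[OF assms]
  by (fastforce simp: diff_ring_def simp del: diff_ops.simps)


section \<open>Automorphisms fixing the Laurent polynomials are conjugations on each level\<close>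

text \<open>
  Here \<open>v j\<close> is the value at \<open>1\<close> of the product of the operators \<open>t + b - l\<close> over \<open>l < j\<close>, where \<open>t\<close> acts
  diagonally. Suppose that \<open>b\<close> is not a constant, and let \<open>g\<close> be an exponent of \<open>b\<close> of maximal
  Euclidean length. By the Cauchy-Schwarz inequality the linear form \<open>h = \<langle>\<cdot>, g\<rangle>\<close> attains its maximum
  over the exponents of \<open>b\<close> at \<open>g\<close> and nowhere else. A diagonal operator creates no new exponents, so
  the top coefficient of \<open>v j\<close> with respect to \<open>h\<close> is the one of \<open>b ^ j\<close>, which is not zero.
  For a constant \<open>b\<close>, the value \<open>v N\<close> is the product of the constants \<open>b - l\<close> over \<open>l < N\<close>, because \<open>t\<close>
  annihilates the constants.
\<close>

lemma constant_of_falling_product_zero: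
  fixes b :: "('n::finite, 'k::field) laurent" and t :: "int ^ 'n \<Rightarrow> 'k"
  assumes t0: "t 0 = 0"
    and v0: "v 0 = 1"
    and vSuc: "\<And>j. v (Suc j) = diag_op t (v j) + b * v j - of_nat j * v j"
    and vN: "v N = 0"
  shows "\<exists>j<N. b = of_nat j"
proof -
  have of_nat_mult_lookup: "Poly_Mapping.lookup (of_nat j * f) \<beta> = of_nat j * Poly_Mapping.lookup f \<beta>"
    for j \<beta> and f :: "('n, 'k) laurent"
    using lookup_single_mult[of 0 "of_nat j" f \<beta>] by simp
  show ?thesis
  proof (cases "Poly_Mapping.keys b \<subseteq> {0}")
    case True
    then obtain c where b: "b = Poly_Mapping.single 0 c"
      by (intro that[of "Poly_Mapping.lookup b 0"] poly_mapping_eqI)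
        (auto simp: lookup_single when_def in_keys_iff)
    have "v j = Poly_Mapping.single 0 (\<Prod>i<j. c - of_nat i)" for j
    proof (induction j)
      case (Suc j)
      show ?case unfolding vSuc Suc.IH b
        by (simp add: diag_op_single t0 mult_single flip: single_of_nat)
          (simp add: algebra_simps flip: single_diff)
    qed (simp add: v0)
    then have "(\<Prod>i<N. c - of_nat i) = 0" using vN
      by (metis lookup_single_eq lookup_zero)
    then obtain i where "i < N" "c = of_nat i" by auto
    then show ?thesis by (auto simp: b)
  next
    case False
    define Q :: "int ^ 'n \<Rightarrow> int" where "Q = (\<lambda>\<gamma>. \<Sum>i\<in>UNIV. (\<gamma> $ i)\<^sup>2)"
    have "Poly_Mapping.keys b \<noteq> {}" using False by auto
    then obtain g where g: "g \<in> Poly_Mapping.keys b"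
      and max: "\<And>\<gamma>. \<gamma> \<in> Poly_Mapping.keys b \<Longrightarrow> Q \<gamma> \<le> Q g"
      using Max_in[of "Q ` Poly_Mapping.keys b"] Max_ge[of "Q ` Poly_Mapping.keys b"] by fastforce
    have Qpos: "Q \<gamma> > 0" if "\<gamma> \<noteq> 0" for \<gamma>
    proof -
      obtain i where "\<gamma> $ i \<noteq> 0" using \<open>\<gamma> \<noteq> 0\<close> by (auto simp: vec_eq_iff)
      then show ?thesis unfolding Q_def by (intro sum_pos2[of _ i]) auto
    qed
    define h :: "int ^ 'n \<Rightarrow> int" where "h = (\<lambda>\<gamma>. \<Sum>i\<in>UNIV. \<gamma> $ i * g $ i)"
    have h_diff: "h (\<beta> - \<gamma>) = h \<beta> - h \<gamma>" for \<beta> \<gamma>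
      by (simp add: h_def left_diff_distrib sum_subtractf)
    have hg: "h g = Q g" by (simp add: h_def Q_def power2_eq_square)
    have polar: "Q (\<gamma> - g) = Q \<gamma> - 2 * h \<gamma> + Q g" for \<gamma>
      by (simp add: Q_def h_def power2_eq_square algebra_simps sum.distrib sum_subtractf sum_distrib_left)
    have less: "h \<gamma> < Q g" if "\<gamma> \<in> Poly_Mapping.keys b" "\<gamma> \<noteq> g" for \<gamma>
      using Qpos[of "\<gamma> - g"] polar[of \<gamma>] max[OF that(1)] that(2) by simp
    have R: "Q g > 0"
    proof -
      obtain \<gamma> where "\<gamma> \<in> Poly_Mapping.keys b" "\<gamma> \<noteq> 0" using False by auto
      then show ?thesis using Qpos[of \<gamma>] max[of \<gamma>] by simp
    qed
    let ?c = "Poly_Mapping.lookup b g"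
    \<comment> \<open>The second clause describes \<open>\<beta> = j g\<close> by its coordinates.\<close>
    have "(\<forall>\<beta>. h \<beta> > int j * Q g \<longrightarrow> Poly_Mapping.lookup (v j) \<beta> = 0) \<and>
        (\<forall>\<beta>. (\<forall>i. \<beta> $ i = int j * g $ i) \<longrightarrow> Poly_Mapping.lookup (v j) \<beta> = ?c ^ j)" for j
    proof (induction j)
      case 0
      have "\<beta> = 0" if "\<forall>i. \<beta> $ i = 0" for \<beta> :: "int ^ 'n" using that by (simp add: vec_eq_iff)
      then show ?case by (auto simp: v0 lookup_one when_def h_def)
    next
      case (Suc j)
      have high: "Poly_Mapping.lookup (v j) \<beta> = 0" if "h \<beta> > int j * Q g" for \<beta>
        using Suc that by blast
      have step: "Poly_Mapping.lookup (v (Suc j)) \<beta> =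
          (\<Sum>\<gamma>\<in>Poly_Mapping.keys b. Poly_Mapping.lookup b \<gamma> * Poly_Mapping.lookup (v j) (\<beta> - \<gamma>))"
        if "h \<beta> \<ge> int (Suc j) * Q g" for \<beta>
      proof -
        have "h \<beta> > int j * Q g" using that R by (simp add: algebra_simps)
        then show ?thesis
          using high[of \<beta>]
          by (simp add: vSuc lookup_add lookup_minus lookup_diag_op of_nat_mult_lookup lookup_mult_keys[of b])
      qed
      show ?case
      proof (intro conjI allI impI)
        fix \<beta> assume \<beta>: "int (Suc j) * Q g < h \<beta>"
        have "Poly_Mapping.lookup (v j) (\<beta> - \<gamma>) = 0" if "\<gamma> \<in> Poly_Mapping.keys b" for \<gamma>
        proof (rule high)
          have "h \<gamma> \<le> Q g" using less[OF that] hg by (cases "\<gamma> = g") auto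
          then show "int j * Q g < h (\<beta> - \<gamma>)" using \<beta> by (simp add: h_diff algebra_simps)
        qed
        then show "Poly_Mapping.lookup (v (Suc j)) \<beta> = 0"
          using \<beta> by (subst step) (auto intro!: sum.neutral)
      next
        fix \<beta> assume \<beta>: "\<forall>i. \<beta> $ i = int (Suc j) * g $ i"
        have h\<beta>: "h \<beta> = int (Suc j) * Q g"
          unfolding hg[symmetric] using \<beta> by (simp add: h_def sum_distrib_left mult.assoc)
        have "Poly_Mapping.lookup b \<gamma> * Poly_Mapping.lookup (v j) (\<beta> - \<gamma>) =
            (if \<gamma> = g then ?c ^ Suc j else 0)" if \<gamma>: "\<gamma> \<in> Poly_Mapping.keys b" for \<gamma>
        proof (cases "\<gamma> = g")
          case True
          have "\<forall>i. (\<beta> - \<gamma>) $ i = int j * g $ i" using \<beta> True by (simp add: algebra_simps)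
          then have "Poly_Mapping.lookup (v j) (\<beta> - \<gamma>) = ?c ^ j" using Suc by blast
          then show ?thesis using True by simp
        next
          case False
          have "int j * Q g < h (\<beta> - \<gamma>)"
            using less[OF \<gamma> False] by (simp add: h_diff h\<beta> algebra_simps)
          then show ?thesis using False high by simp
        qed
        then have "Poly_Mapping.lookup (v (Suc j)) \<beta> =
            (\<Sum>\<gamma>\<in>Poly_Mapping.keys b. if \<gamma> = g then ?c ^ Suc j else 0)"
          using h\<beta> by (subst step) (auto intro!: sum.cong)
        then show "Poly_Mapping.lookup (v (Suc j)) \<beta> = ?c ^ Suc j" using g by simp
      qed
    qed
    from this[of N] have "\<forall>\<beta>. (\<forall>i. \<beta> $ i = int N * g $ i) \<longrightarrow> 0 = ?c ^ N"
      by (simp add: vN)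
    from this[rule_format, of "\<chi> i. int N * g $ i"] have "?c = 0" by auto
    then show ?thesis using g by (simp add: in_keys_iff)
  qed
qed

text \<open>
  Evaluating \<open>u f = u (f 1) = f u(1)\<close> shows that \<open>L\<close> is its own centralizer.
\<close>

lemma mult_op_if_commutes_with_all_mult_ops:
  assumes "K_linear u" "\<And>a. commutator (mult_op a) u = (\<lambda>_. 0)"
  shows "u = mult_op (u 1)"
proof
  fix f
  show "u f = mult_op (u 1) f"
    using assms(2)[of f, THEN fun_cong, of 1]
    by (simp add: commutator_def mult_op_def mult.commute)
qed

text \<open>
  The difference \<open>\<tau>(T) - T\<close> commutes with \<open>L\<close> because \<open>\<tau>\<close> fixes the commutators of \<open>T\<close> with elements of \<open>L\<close>,
  so it is multiplication by some \<open>b\<close>. The scalars by which \<open>T\<close> acts lie in the prime field, so the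
  product of the \<open>T - l\<close> over \<open>l < p\<close> is zero; the same holds for \<open>T + b\<close>, and this forces \<open>b\<close> to be a
  constant in the prime field.
\<close>

lemma digit_op_image:
  fixes \<tau> :: "('n::finite, 'k::field) laurent_op \<Rightarrow> ('n, 'k) laurent_op"
  assumes prime: "prime CHAR('k)" and q: "q > 0"
    and S: "op_subalgebra S" "\<And>u. u \<in> S \<Longrightarrow> K_linear u" "level_ops q \<subseteq> S" "\<And>i. digit_op q i \<in> S"
    and closed: "\<And>u. u \<in> S \<Longrightarrow> K_linear (\<tau> u)"
    and mult: "\<And>u v. u \<in> S \<Longrightarrow> v \<in> S \<Longrightarrow> \<tau> (u \<circ> v) = \<tau> u \<circ> \<tau> v"
    and add: "\<And>u v. u \<in> S \<Longrightarrow> v \<in> S \<Longrightarrow> \<tau> (\<lambda>f. u f + v f) = (\<lambda>f. \<tau> u f + \<tau> v f)"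
    and fix_level: "\<And>u. u \<in> level_ops q \<Longrightarrow> \<tau> u = u"
  shows "\<exists>j::nat. \<tau> (digit_op q i) = (\<lambda>f. digit_op q i f + of_nat j * f)"
proof -
  let ?T = "digit_op q i :: ('n, 'k) laurent_op"
  let ?t = "\<lambda>\<beta>. of_int (\<beta> $ i div int q) :: 'k"
  have mult_opL: "mult_op a \<in> level_ops q" for a :: "('n, 'k) laurent"
    using op_subalgebra_level_ops unfolding op_subalgebra_def by blast
  have mult_opS: "mult_op a \<in> S" and compS: "u \<in> S \<Longrightarrow> v \<in> S \<Longrightarrow> u \<circ> v \<in> S"
    and addS: "u \<in> S \<Longrightarrow> v \<in> S \<Longrightarrow> (\<lambda>f. u f + v f) \<in> S" for a u v
    using S(1) by (simp_all add: op_subalgebra_def)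
  have \<tau>_mult_op: "\<tau> (mult_op a) = mult_op a" for a by (rule fix_level[OF mult_opL])
  define \<delta> where "\<delta> = (\<lambda>f. \<tau> ?T f - ?T f)"
  \<comment> \<open>The map \<open>\<tau>\<close> respects sums and compositions; the commutator is written in terms of these.\<close>
  have comm: "a * \<tau> ?T f - \<tau> ?T (a * f) = a * ?T f - ?T (a * f)" for a f
  proof -
    let ?C = "commutator (mult_op a) ?T"
    have L: "?C \<in> level_ops q" by (rule commutator_digit_op[OF q])
    have split: "(\<lambda>f. (mult_op (-1) \<circ> (?T \<circ> mult_op a)) f + (mult_op a \<circ> ?T) f) = ?C"
      by (simp add: fun_eq_iff commutator_def mult_op_def)
    have "\<tau> ?C = (\<lambda>f. (mult_op (-1) \<circ> (\<tau> ?T \<circ> mult_op a)) f + (mult_op a \<circ> \<tau> ?T) f)"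
      unfolding split[symmetric]
      by (simp only: add mult compS mult_opS S(4) \<tau>_mult_op)
    with fix_level[OF L] show ?thesis
      by (simp add: fun_eq_iff commutator_def mult_op_def)
  qed
  have "\<delta> = mult_op (\<delta> 1)"
  proof (rule mult_op_if_commutes_with_all_mult_ops)
    have "\<delta> = (\<lambda>f. \<tau> ?T f + (mult_op (-1) \<circ> ?T) f)" by (simp add: \<delta>_def mult_op_def fun_eq_iff)
    then show "K_linear \<delta>" by (simp only: K_linear_add K_linear_comp K_linear_mult_op S(2,4) closed)
    show "commutator (mult_op a) \<delta> = (\<lambda>_. 0)" for a
      using comm[of a] by (simp add: \<delta>_def commutator_def mult_op_def fun_eq_iff algebra_simps)
  qed
  then obtain b where b: "\<And>f. \<tau> ?T f = ?T f + b * f"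
    unfolding \<delta>_def mult_op_def fun_eq_iff by (metis add.commute diff_eq_eq)
  define P :: "nat \<Rightarrow> ('n, 'k) laurent_op" where
    "P = rec_nat id (\<lambda>j u. (\<lambda>f. ?T f + mult_op (- of_nat j) f) \<circ> u)"
  have P0: "P 0 = mult_op 1" by (simp add: P_def mult_op_def fun_eq_iff)
  have PSuc: "P (Suc j) = (\<lambda>f. ?T f + mult_op (- of_nat j) f) \<circ> P j" for j by (simp add: P_def)
  have PS: "P j \<in> S" for j
    by (induction j) (simp_all only: P0 PSuc mult_opS compS addS S(4))
  have \<tau>P: "\<tau> (P (Suc j)) = (\<lambda>f. \<tau> ?T f + mult_op (- of_nat j) f) \<circ> \<tau> (P j)" for j
    unfolding PSuc by (simp add: mult add addS mult_opS S(4) PS \<tau>_mult_op)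
  have const: "mult_op (- of_nat j) = diag_op (\<lambda>_. - of_nat j :: 'k)" for j
    by (simp add: diag_op_const single_uminus)
  have P_diag: "P j = diag_op (\<lambda>\<beta>. \<Prod>l<j. ?t \<beta> - of_nat l)" for j
  proof (induction j)
    case 0
    then show ?case by (simp add: P0 diag_op_const)
  next
    case (Suc j)
    show ?case
      unfolding PSuc Suc.IH const digit_op_def
      by (simp add: diag_op_mult[symmetric] diag_op_add[symmetric] mult.commute)
  qed
  have prod0: "(\<Prod>l<CHAR('k). ?t \<beta> - of_nat l) = 0" for \<beta> :: "int ^ 'n"
  proof -
    let ?x = "\<beta> $ i div int q" and ?p = "int CHAR('k)"
    have p: "?p > 0" using prime_gt_0_nat[OF prime] by simp
    have "(of_int ?x :: 'k) = of_int (int (nat (?x mod ?p)))"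
      unfolding of_int_eq_iff_cong_CHAR using p by (simp add: cong_def)
    then have "of_int ?x = (of_nat (nat (?x mod ?p)) :: 'k)" by simp
    moreover have "nat (?x mod ?p) < CHAR('k)" using p by (simp add: nat_less_iff)
    ultimately have "nat (?x mod ?p) \<in> {..<CHAR('k)}" "of_int ?x - (of_nat (nat (?x mod ?p)) :: 'k) = 0"
      by simp_all
    then show ?thesis by (intro prod_zero finite_lessThan bexI)
  qed
  have Pp: "P CHAR('k) = mult_op 0"
    unfolding P_diag prod0 diag_op_const by simp
  have "\<exists>j<CHAR('k). b = of_nat j"
  proof (rule constant_of_falling_product_zero)
    show "?t 0 = 0" by simp
    show "\<tau> (P 0) 1 = 1" unfolding P0 \<tau>_mult_op by (simp add: mult_op_def)
    show "\<tau> (P (Suc j)) 1 = diag_op ?t (\<tau> (P j) 1) + b * \<tau> (P j) 1 - of_nat j * \<tau> (P j) 1" for j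
      unfolding \<tau>P by (simp add: b mult_op_def) (simp add: digit_op_def)
    show "\<tau> (P CHAR('k)) 1 = 0" unfolding Pp \<tau>_mult_op by (simp add: mult_op_def)
  qed
  then show ?thesis using b by (auto simp: fun_eq_iff)
qed

text \<open>
  Passing from level \<open>q\<close> to level \<open>p q\<close>, the map \<open>\<tau> u = x\<^sup>m \<sigma>(u) x\<^sup>-\<^sup>m\<close> is the identity on level \<open>q\<close> and
  adds to each digit operator an integer \<open>j i\<close>. Conjugation by \<open>x\<^sup>n\<close> with \<open>n $ i = q * j i\<close> does the same, so
  the two agree on everything generated by level \<open>q\<close> and the digit operators.
\<close>

lemma level_ops_conj:
  fixes \<sigma> :: "('n::finite, 'k::field) laurent_op \<Rightarrow> ('n, 'k) laurent_op"
  assumes prime: "prime CHAR('k)"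
    and closed: "\<And>u. u \<in> carrier diff_ring \<Longrightarrow> \<sigma> u \<in> carrier diff_ring"
    and mult: "\<And>u v. u \<in> carrier diff_ring \<Longrightarrow> v \<in> carrier diff_ring \<Longrightarrow> \<sigma> (u \<circ> v) = \<sigma> u \<circ> \<sigma> v"
    and add: "\<And>u v. u \<in> carrier diff_ring \<Longrightarrow> v \<in> carrier diff_ring \<Longrightarrow>
      \<sigma> (\<lambda>f. u f + v f) = (\<lambda>f. \<sigma> u f + \<sigma> v f)"
    and fixed: "\<And>a. \<sigma> (mult_op a) = mult_op a"
  shows "\<exists>m. \<forall>u\<in>level_ops (CHAR('k) ^ k). \<sigma> u = conj_op m u"
proof (induction k)
  case 0
  have "\<forall>u\<in>level_ops (CHAR('k) ^ 0). \<sigma> u = conj_op 0 u"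
    unfolding power_0 level_ops_one by (simp add: fixed conj_op_zero)
  then show ?case by blast
next
  case (Suc k)
  let ?q = "CHAR('k) ^ k" and ?D = "carrier diff_ring :: ('n, 'k) laurent_op set"
  from Suc obtain m where m: "\<And>u. u \<in> level_ops ?q \<Longrightarrow> \<sigma> u = conj_op m u" by blast
  have q: "?q > 0" using prime_gt_0_nat[OF prime] by simp
  have levelD: "level_ops (CHAR('k) ^ l) \<subseteq> ?D" for l
    unfolding diff_ring_carrier[OF prime] by blast
  have linD: "K_linear u" if "u \<in> ?D" for u
    using that diff_ops_linear by (auto simp: diff_ring_def simp del: diff_ops.simps)
  have digitD: "digit_op ?q i \<in> ?D" for i
    using digit_op_level[OF q] levelD[of "Suc k"] by auto
  define \<tau> where "\<tau> = (\<lambda>u. conj_op (- m) (\<sigma> u))"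
  have \<tau>_mult: "\<tau> (u \<circ> v) = \<tau> u \<circ> \<tau> v" if "u \<in> ?D" "v \<in> ?D" for u v
    by (simp only: \<tau>_def mult[OF that] conj_op_comp)
  have \<tau>_add: "\<tau> (\<lambda>f. u f + v f) = (\<lambda>f. \<tau> u f + \<tau> v f)" if "u \<in> ?D" "v \<in> ?D" for u v
    by (simp only: \<tau>_def add[OF that] conj_op_add)
  have \<tau>_level: "\<tau> u = u" if "u \<in> level_ops ?q" for u
    by (simp add: \<tau>_def m[OF that] conj_op_conj_op conj_op_zero)
  have "\<forall>i. \<exists>j::nat. \<tau> (digit_op ?q i) = (\<lambda>f. digit_op ?q i f + of_nat j * f)"
  proof
    fix i
    show "\<exists>j::nat. \<tau> (digit_op ?q i) = (\<lambda>f. digit_op ?q i f + of_nat j * f)"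
    proof (rule digit_op_image[OF prime q op_subalgebra_diff_ring linD levelD digitD _ \<tau>_mult \<tau>_add \<tau>_level])
      show "K_linear (\<tau> u)" if "u \<in> ?D" for u
        unfolding \<tau>_def by (rule linD[OF conj_op_mem[OF op_subalgebra_diff_ring closed[OF that]]])
    qed
  qed
  then obtain j :: "'n \<Rightarrow> nat" where j: "\<And>i. \<tau> (digit_op ?q i) = (\<lambda>f. digit_op ?q i f + of_nat (j i) * f)"
    by metis
  define n :: "int ^ 'n" where "n = (\<chi> i. int ?q * int (j i))"
  have n_level: "conj_op n u = u" if "u \<in> level_ops ?q" for u
  proof -
    have "conj_op n u = conj_op 0 u" using that by (rule conj_op_cong) (simp add: n_def cong_def)
    then show ?thesis by (simp add: conj_op_zero)
  qed
  have n_digit: "conj_op n (digit_op ?q i) = \<tau> (digit_op ?q i)" for i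
  proof -
    have "(\<beta> $ i + n $ i) div int ?q = \<beta> $ i div int ?q + int (j i)" for \<beta> :: "int ^ 'n"
      using q by (simp add: n_def)
    then have "conj_op n (digit_op ?q i) = diag_op (\<lambda>\<beta>. of_int (\<beta> $ i div int ?q) + (of_nat (j i) :: 'k))"
      by (simp only: digit_op_def conj_op_diag_op vector_add_component of_int_add of_int_of_nat_eq)
    then show ?thesis
      unfolding j diag_op_add diag_op_const by (simp add: digit_op_def mult_op_def)
  qed
  define S where "S = {u \<in> ?D. \<tau> u = conj_op n u}"
  have "op_subalgebra S"
    using op_subalgebra_diff_ring[where ?'n = 'n and ?'k = 'k] unfolding S_def op_subalgebra_def
    by (auto simp: \<tau>_mult \<tau>_add conj_op_comp conj_op_add) (simp_all add: \<tau>_def fixed conj_op_mult_op)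
  moreover have "residue_proj ?q \<in> S"
    using residue_proj_level[of ?q] levelD[of k] by (auto simp: S_def \<tau>_level n_level)
  moreover have "digit_op ?q i \<in> S" for i by (simp add: S_def digitD n_digit)
  ultimately have "level_ops (CHAR('k) ^ Suc k) \<subseteq> S"
    using residue_proj_mult[OF prime q] q prime_gt_0_nat[OF prime]
    by (intro level_ops_subset_subalgebra) auto
  then have "conj_op m (conj_op (- m) (\<sigma> u)) = conj_op m (conj_op n u)"
    if "u \<in> level_ops (CHAR('k) ^ Suc k)" for u
    using that by (auto simp: S_def \<tau>_def)
  then have "\<forall>u\<in>level_ops (CHAR('k) ^ Suc k). \<sigma> u = conj_op (m + n) u"
    by (simp only: conj_op_conj_op) (simp add: conj_op_zero)
  then show ?case by blast
qed


section \<open>Binomial coefficients modulo a prime\<close>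

lemma int_binom_0: "int_binom t 0 = 1"
  by (simp add: int_binom_def)

lemma int_binom_Suc_Suc: "int_binom (t + 1) (Suc j) = int_binom t (Suc j) + int_binom t j"
proof -
  have shift: "(\<Prod>i<Suc j. (t + 1) - int i) = (t + 1) * (\<Prod>i<j. t - int i)"
    by (subst prod.lessThan_Suc_shift) (simp add: algebra_simps)
  have "fact (Suc j) * int_binom (t + 1) (Suc j) = (t + 1) * (fact j * int_binom t j)"
    unfolding int_binom_mult_fact shift ..
  also have "\<dots> = (t - int j) * (fact j * int_binom t j) + int (Suc j) * (fact j * int_binom t j)"
    by (simp add: algebra_simps)
  also have "(t - int j) * (fact j * int_binom t j) = fact (Suc j) * int_binom t (Suc j)"
    unfolding int_binom_mult_fact by simp
  also have "int (Suc j) * (fact j * int_binom t j) = fact (Suc j) * int_binom t j"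
    by (simp add: algebra_simps)
  finally have "fact (Suc j) * int_binom (t + 1) (Suc j) =
      fact (Suc j) * (int_binom t (Suc j) + int_binom t j)"
    by (simp only: distrib_left)
  then show ?thesis by (simp del: fact_Suc)
qed

lemma int_binom_nat: "int_binom (int n) j = int (n choose j)"
proof (induction n arbitrary: j)
  case 0
  show ?case
  proof (cases j)
    case (Suc i)
    then have "fact j * int_binom 0 j = 0" unfolding int_binom_mult_fact by auto
    then show ?thesis using Suc by simp
  qed (simp add: int_binom_0)
next
  case (Suc n)
  show ?case
  proof (cases j)
    case (Suc i)
    have "int_binom (int (Suc n)) j = int_binom (int n + 1) (Suc i)" using Suc by (simp add: add.commute)
    then show ?thesis unfolding int_binom_Suc_Suc Suc.IH using Suc by simp
  qed (simp add: int_binom_0)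
qed

lemma prime_dvd_choose_prime_power:
  fixes p :: nat
  assumes "prime p" "0 < j" "j < p ^ K"
  shows "p dvd p ^ K choose j"
proof (rule ccontr)
  assume "\<not> p dvd p ^ K choose j"
  then have "coprime (p ^ K) (p ^ K choose j)" using assms(1) by (simp add: prime_imp_coprime)
  moreover have "p ^ K dvd j * (p ^ K choose j)"
    using times_binomial_minus1_eq[OF assms(2), of "p ^ K"] by simp
  ultimately have "p ^ K dvd j" by (simp add: coprime_dvd_mult_left_iff)
  then show False using assms(2,3) by (auto dest: dvd_imp_le)
qed

text \<open>
  By Pascal's rule and induction on \<open>j\<close>, the difference of the coefficients at \<open>t + p ^ K\<close> and at \<open>t\<close> has
  the same residue modulo \<open>p\<close> for all \<open>t\<close>. At \<open>t = 0\<close> this residue is zero, since \<open>p\<close> divides the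
  binomial coefficients \<open>p ^ K choose j\<close> with \<open>0 < j < p ^ K\<close>.
\<close>

lemma int_binom_cong:
  assumes p: "prime p" and "j < p ^ K" and "[x = y] (mod int (p ^ K))"
  shows "[int_binom x j = int_binom y j] (mod int p)"
proof -
  let ?q = "int (p ^ K)"
  have step: "[int_binom (t + ?q) j = int_binom t j] (mod int p)" for t
    using assms(2)
  proof (induction j arbitrary: t)
    case (Suc j)
    have IH: "[int_binom (t + ?q) j = int_binom t j] (mod int p)" for t
      using Suc by simp
    have rec: "int_binom (t + 1 + ?q) (Suc j) - int_binom (t + 1) (Suc j) =
        (int_binom (t + ?q) (Suc j) - int_binom t (Suc j)) + (int_binom (t + ?q) j - int_binom t j)" for t
      using int_binom_Suc_Suc[of "t + ?q" j] int_binom_Suc_Suc[of t j] by (simp add: ac_simps)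
    have iff: "int p dvd int_binom (t + 1 + ?q) (Suc j) - int_binom (t + 1) (Suc j) \<longleftrightarrow>
        int p dvd int_binom (t + ?q) (Suc j) - int_binom t (Suc j)" for t
      unfolding rec using IH[of t] by (simp add: cong_iff_dvd_diff dvd_add_left_iff)
    have "int p dvd int_binom (t + ?q) (Suc j) - int_binom t (Suc j)"
    proof (induction t rule: int_induct[where k = 0])
      case base
      have "int p dvd int (p ^ K choose Suc j)"
        using prime_dvd_choose_prime_power[OF p _ Suc.prems] by (simp only: int_dvd_int_iff)
      then show ?case
        using int_binom_nat[of "p ^ K" "Suc j"] int_binom_nat[of 0 "Suc j"] by simp
    next
      case (step1 t)
      then show ?case using iff[of t] by blast
    next
      case (step2 t)
      then show ?case using iff[of "t - 1"] by (simp only: diff_add_cancel)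
    qed
    then show ?case by (simp add: cong_iff_dvd_diff)
  qed (simp add: int_binom_0)
  have steps: "[int_binom (t + int n * ?q) j = int_binom t j] (mod int p)" for t n
  proof (induction n)
    case (Suc n)
    have "t + int (Suc n) * ?q = t + int n * ?q + ?q" by (simp add: algebra_simps)
    then show ?case using Suc step[of "t + int n * ?q"] by (metis cong_trans)
  qed simp
  obtain z where z: "x = y + z * ?q" using assms(3)
    by (metis cong_iff_lin mult.commute cong_sym)
  show ?thesis
  proof (cases "z \<ge> 0")
    case True
    then show ?thesis using steps[of y "nat z"] z by simp
  next
    case False
    then have "y = x + int (nat (- z)) * ?q" using z by simp
    then show ?thesis using steps[of x "nat (- z)"] cong_sym by metis
  qed
qed

lemma divided_diff_level:
  fixes \<alpha> :: "nat ^ 'n::finite"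
  assumes "prime CHAR('k::field)" "\<And>i. \<alpha> $ i < CHAR('k) ^ K"
  shows "(divided_diff \<alpha> :: ('n, 'k) laurent_op) \<in> level_ops (CHAR('k) ^ K)"
proof -
  define c :: "int ^ 'n \<Rightarrow> 'k" where "c = (\<lambda>\<beta>. of_int (\<Prod>i\<in>UNIV. int_binom (\<beta> $ i) (\<alpha> $ i)))"
  have "divided_diff \<alpha> = mult_op (Poly_Mapping.single (- (\<chi> i. int (\<alpha> $ i))) 1) \<circ> diag_op c"
    by (rule ext, rule poly_mapping_eqI)
      (simp add: divided_diff_def c_def lookup_monomial_op mult_op_def lookup_single_mult lookup_diag_op)
  moreover have "diag_op c \<in> level_ops (CHAR('k) ^ K)"
  proof (rule diag_op_level)
    fix \<beta> \<gamma> :: "int ^ 'n" assume "\<And>i. int (CHAR('k) ^ K) dvd \<gamma> $ i"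
    then have "[int_binom ((\<beta> + \<gamma>) $ i) (\<alpha> $ i) = int_binom (\<beta> $ i) (\<alpha> $ i)] (mod int CHAR('k))" for i
      by (intro int_binom_cong[OF assms]) (simp add: cong_iff_dvd_diff)
    then show "c (\<beta> + \<gamma>) = c \<beta>"
      unfolding c_def of_int_eq_iff_cong_CHAR by (intro cong_prod) auto
  qed
  ultimately show ?thesis using op_subalgebra_level_ops unfolding op_subalgebra_def by metis
qed

text \<open>
  The operator on the right multiplies \<open>x\<^sup>\<beta>\<close> by the product of the binomial coefficients
  \<open>\<beta>\<^sub>i + q - 1 choose q - 1\<close>. Modulo \<open>p\<close> these are periodic with period \<open>q\<close>; they are \<open>1\<close> for \<open>\<beta>\<^sub>i = 0\<close>,
  and for \<open>0 < \<beta>\<^sub>i < q\<close> they agree with \<open>\<beta>\<^sub>i - 1 choose q - 1\<close>, which vanishes.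
\<close>

lemma residue_proj_eq_divided_diff:
  fixes K :: nat
  assumes prime: "prime CHAR('k::field)"
  defines "q \<equiv> CHAR('k) ^ K"
  shows "(residue_proj q :: ('n::finite, 'k) laurent_op) =
    divided_diff (\<chi> i. q - 1) \<circ> mult_op (Poly_Mapping.single (\<chi> i. int (q - 1)) 1)"
proof (rule ext, rule poly_mapping_eqI)
  fix f :: "('n, 'k) laurent" and \<beta> :: "int ^ 'n"
  have q: "q > 0" unfolding q_def using prime_gt_0_nat[OF prime] by simp
  have binom: "(of_int (int_binom (x + int (q - 1)) (q - 1)) :: 'k) = (if int q dvd x then 1 else 0)" for x
  proof -
    define r where "r = (if int q dvd x then q - 1 else nat (x mod int q) - 1)"
    have "[x + int (q - 1) = int r] (mod int q)"
    proof (cases "int q dvd x")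
      case True
      then show ?thesis by (simp add: r_def cong_iff_dvd_diff)
    next
      case False
      have "x mod int q \<noteq> 0" "x mod int q \<ge> 0" using False q by (auto simp: dvd_eq_mod_eq_0)
      then have "x mod int q > 0" by simp
      then have "int r = x mod int q - 1" using False by (simp add: r_def)
      moreover have "x + int (q - 1) - (x mod int q - 1) = int q * (x div int q + 1)"
        using q by (simp add: algebra_simps of_nat_diff minus_mod_eq_mult_div)
      ultimately show ?thesis by (simp add: cong_iff_dvd_diff)
    qed
    then have "(of_int (int_binom (x + int (q - 1)) (q - 1)) :: 'k) = of_int (int_binom (int r) (q - 1))"
      unfolding of_int_eq_iff_cong_CHAR q_def
      using q by (intro int_binom_cong[OF prime]) (auto simp: q_def)
    moreover have "int q dvd x \<or> r < q - 1"
    proof (cases "int q dvd x")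
      case False
      have "x mod int q \<noteq> 0" "x mod int q \<ge> 0" "x mod int q < int q"
        using False q by (auto simp: dvd_eq_mod_eq_0)
      then show ?thesis using False by (auto simp: r_def)
    qed simp
    ultimately show ?thesis
      unfolding int_binom_nat by (auto simp: r_def binomial_eq_0)
  qed
  have "(\<Prod>i\<in>UNIV. (of_int (int_binom (\<beta> $ i + int (q - 1)) (q - 1)) :: 'k)) =
      (if \<forall>i. int q dvd \<beta> $ i then 1 else 0)"
    unfolding binom by (auto intro: prod.neutral)
  then show "Poly_Mapping.lookup (residue_proj q f) \<beta> =
      Poly_Mapping.lookup ((divided_diff (\<chi> i. q - 1) \<circ>
        mult_op (Poly_Mapping.single (\<chi> i. int (q - 1)) 1)) f) \<beta>"
    by (simp add: residue_proj_def lookup_diag_op divided_diff_def lookup_monomial_op mult_op_def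
        lookup_single_mult del: of_nat_diff)
qed

section \<open>The shifted divided powers as conjugates\<close>

text \<open>
  Dividing the falling factorial by \<open>j!\<close> costs \<open>v\<close> p-adic digits, where \<open>v\<close> is the multiplicity of \<open>p\<close> in \<open>j!\<close>. The defining
  equation is therefore read off at the higher index \<open>1 + K + v\<close>, and the periodicity of binomial
  coefficients modulo \<open>p\<close> brings the argument back to index \<open>K\<close>.
\<close>

lemma padic_binom_cong:
  assumes p: "prime p" and t: "t \<in> carrier (padic_ring p)" and j: "j < p ^ K"
  shows "[padic_binom p t j 1 = int_binom (t K) j] (mod int p)"
    and "padic_binom p t j \<in> carrier (padic_ring p)"
proof -
  define b where "b = padic_binom p t j"
  have p0: "p > 0" using p by (rule prime_gt_0_nat)
  have b: "b \<in> carrier (padic_ring p) \<and> padic_of_int p (fact j) \<otimes>\<^bsub>padic_ring p\<^esub> b =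
      finprod (padic_ring p) (\<lambda>i. t \<ominus>\<^bsub>padic_ring p\<^esub> padic_of_int p (int i)) {..<j}"
    unfolding b_def padic_binom_def by (rule theI'[OF padic_binom_ex1[OF p t]])
  then show "padic_binom p t j \<in> carrier (padic_ring p)" by (simp add: b_def)
  define v where "v = multiplicity p (fact j)"
  let ?N = "1 + K + v"
  have "[fact j * b ?N = fact j * int_binom (t ?N) j] (mod int p ^ ?N)"
    using b[THEN conjunct2, THEN fun_cong, of ?N]
    unfolding padic_falling[OF p0 t]
    by (simp add: padic_mult padic_of_int_def cong_def mod_mult_left_eq)
  then have "[b ?N = int_binom (t ?N) j] (mod int p ^ (1 + K))"
    unfolding v_def by (rule fact_cancel_cong[OF p])
  then have 1: "[b ?N = int_binom (t ?N) j] (mod int p)"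
    by (rule cong_dvd_modulus) simp
  have 2: "[b ?N = b 1] (mod int p)"
    using padic_cong_add[of b p 1 "K + v"] b by (simp add: add.assoc)
  have "[t ?N = t K] (mod int (p ^ K))"
    using padic_cong_add[OF t, of K "1 + v"] by (simp add: add.commute add.left_commute)
  then have 3: "[int_binom (t ?N) j = int_binom (t K) j] (mod int p)"
    by (rule int_binom_cong[OF p j])
  show "[padic_binom p t j 1 = int_binom (t K) j] (mod int p)"
    using 1 2 3 unfolding b_def[symmetric] by (meson cong_sym cong_trans)
qed

lemma padic_finprod:
  assumes "p > 0" "finite A" "\<And>i. i \<in> A \<Longrightarrow> g i \<in> carrier (padic_ring p)"
  shows "finprod (padic_ring p) g A k = (\<Prod>i\<in>A. g i k) mod int p ^ k"
proof -
  interpret cring "padic_ring p" by (rule padic_cring[OF assms(1)])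
  show ?thesis using assms(2,3)
  proof induction
    case empty
    show ?case by simp (simp add: padic_ring_def)
  next
    case (insert x A)
    have "finprod (padic_ring p) g (insert x A) = g x \<otimes>\<^bsub>padic_ring p\<^esub> finprod (padic_ring p) g A"
      by (rule finprod_insert) (use insert in auto)
    then show ?case using insert by (simp add: padic_mult mod_mult_right_eq)
  qed
qed

definition approx :: "('n \<Rightarrow> padic) \<Rightarrow> nat \<Rightarrow> int ^ 'n::finite" where
  "approx s k = (\<chi> i. s i k)"

lemma padic_vectors_mem:
  "s \<in> carrier (padic_vectors p) \<longleftrightarrow> (\<forall>i. s i \<in> carrier (padic_ring p))"
  by (auto simp: padic_vectors_def)

lemma shifted_divided_diff_eq:
  fixes s :: "'n::finite \<Rightarrow> padic"
  assumes prime: "prime CHAR('k::field)" and s: "s \<in> carrier (padic_vectors CHAR('k))"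
    and K: "\<And>i. \<alpha> $ i < CHAR('k) ^ K"
  shows "(shifted_divided_diff CHAR('k) s \<alpha> :: ('n, 'k) laurent_op) =
    conj_op (approx s K) (divided_diff \<alpha>)"
proof -
  let ?p = "CHAR('k)"
  have p0: "?p > 0" using prime by (rule prime_gt_0_nat)
  interpret cring "padic_ring ?p" by (rule padic_cring[OF p0])
  let ?t = "\<lambda>\<beta> i. padic_of_int ?p (\<beta> $ i) \<oplus>\<^bsub>padic_ring ?p\<^esub> s i"
  have t: "?t \<beta> i \<in> carrier (padic_ring ?p)" for \<beta> :: "int ^ 'n" and i
    using s by (simp add: padic_vectors_mem padic_of_int_mem[OF p0])
  have "(of_int (finprod (padic_ring ?p) (\<lambda>i. padic_binom ?p (?t \<beta> i) (\<alpha> $ i)) UNIV 1) :: 'k) =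
      of_int (\<Prod>i\<in>UNIV. int_binom ((\<beta> + approx s K) $ i) (\<alpha> $ i))" for \<beta> :: "int ^ 'n"
  proof -
    have "[padic_binom ?p (?t \<beta> i) (\<alpha> $ i) 1 = int_binom ((\<beta> + approx s K) $ i) (\<alpha> $ i)] (mod int ?p)" for i
    proof (rule cong_trans[OF padic_binom_cong(1)[OF prime t K]])
      show "[int_binom (?t \<beta> i K) (\<alpha> $ i) = int_binom ((\<beta> + approx s K) $ i) (\<alpha> $ i)] (mod int ?p)"
        by (rule int_binom_cong[OF prime K])
          (simp add: padic_add padic_of_int_def approx_def cong_def mod_add_left_eq)
    qed
    then have "[(\<Prod>i\<in>UNIV. padic_binom ?p (?t \<beta> i) (\<alpha> $ i) 1) =
        (\<Prod>i\<in>UNIV. int_binom ((\<beta> + approx s K) $ i) (\<alpha> $ i))] (mod int ?p)"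
      by (intro cong_prod)
    moreover have "finprod (padic_ring ?p) (\<lambda>i. padic_binom ?p (?t \<beta> i) (\<alpha> $ i)) UNIV 1 =
        (\<Prod>i\<in>UNIV. padic_binom ?p (?t \<beta> i) (\<alpha> $ i) 1) mod int ?p ^ 1"
      by (rule padic_finprod[OF p0]) (use padic_binom_cong(2)[OF prime t K] in auto)
    ultimately show ?thesis unfolding of_int_eq_iff_cong_CHAR by (simp add: cong_def)
  qed
  then show ?thesis
    unfolding shifted_divided_diff_def divided_diff_def conj_op_monomial_op by simp
qed

section \<open>Conjugation by a p-adic power\<close>

text \<open>
  This is \<open>u \<mapsto> x\<^sup>-\<^sup>s u x\<^sup>s\<close>. By \<open>conj_op_cong\<close> any level containing \<open>u\<close> gives the same result (see
  \<open>padic_conj_level\<close>); the least one is taken to have a definite choice.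
\<close>

definition padic_conj ::
  "nat \<Rightarrow> ('n \<Rightarrow> padic) \<Rightarrow> ('n::finite, 'k::field) laurent_op \<Rightarrow> ('n, 'k) laurent_op" where
  "padic_conj p s = (\<lambda>u\<in>carrier diff_ring. conj_op (approx s (LEAST k. u \<in> level_ops (p ^ k))) u)"

lemma approx_cong:
  assumes s: "s \<in> carrier (padic_vectors p)" and "k \<le> l"
  shows "[approx s l $ i = approx s k $ i] (mod int (p ^ k))"
  using padic_cong_add[of "s i" p k "l - k"] assms by (simp add: approx_def padic_vectors_mem)

lemma level_ops_diff_ring:
  "prime CHAR('k::field) \<Longrightarrow>
    (level_ops (CHAR('k) ^ k) :: ('n::finite, 'k) laurent_op set) \<subseteq> carrier diff_ring"
  using diff_ring_carrier by blast

lemma padic_conj_level: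
  fixes u :: "('n::finite, 'k::field) laurent_op"
  assumes prime: "prime CHAR('k)" and s: "s \<in> carrier (padic_vectors CHAR('k))"
    and u: "u \<in> level_ops (CHAR('k) ^ k)"
  shows "padic_conj CHAR('k) s u = conj_op (approx s k) u"
proof -
  define l where "l = (LEAST k. u \<in> level_ops (CHAR('k) ^ k))"
  have "u \<in> level_ops (CHAR('k) ^ l)" "l \<le> k"
    using u unfolding l_def by (auto intro: LeastI Least_le)
  then have "conj_op (approx s k) u = conj_op (approx s l) u"
    by (intro conj_op_cong[of u "CHAR('k) ^ l"] approx_cong[OF s])
  then show ?thesis
    using u level_ops_diff_ring[OF prime] by (auto simp: padic_conj_def l_def)
qed

lemma diff_ring_common_level:
  fixes u v :: "('n::finite, 'k::field) laurent_op"
  assumes prime: "prime CHAR('k)" and "u \<in> carrier diff_ring" "v \<in> carrier diff_ring"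
  obtains k where "u \<in> level_ops (CHAR('k) ^ k)" "v \<in> level_ops (CHAR('k) ^ k)"
proof -
  obtain k l where "u \<in> level_ops (CHAR('k) ^ k)" "v \<in> level_ops (CHAR('k) ^ l)"
    using assms by (auto simp: diff_ring_carrier)
  then have "u \<in> level_ops (CHAR('k) ^ max k l)" "v \<in> level_ops (CHAR('k) ^ max k l)"
    using level_ops_mono[OF le_imp_power_dvd] by (meson max.cobounded1 max.cobounded2 subsetD)+
  then show ?thesis by (rule that)
qed

lemma padic_conj_mem: "u \<in> carrier diff_ring \<Longrightarrow> padic_conj p s u \<in> carrier diff_ring"
  by (simp add: padic_conj_def conj_op_mem[OF op_subalgebra_diff_ring])

lemma padic_conj_compose:
  fixes u :: "('n::finite, 'k::field) laurent_op"
  assumes prime: "prime CHAR('k)"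
    and s: "s \<in> carrier (padic_vectors CHAR('k))" and t: "t \<in> carrier (padic_vectors CHAR('k))"
    and u: "u \<in> carrier diff_ring"
  shows "padic_conj CHAR('k) s (padic_conj CHAR('k) t u) =
    padic_conj CHAR('k) (s \<otimes>\<^bsub>padic_vectors CHAR('k)\<^esub> t) u"
proof -
  let ?st = "s \<otimes>\<^bsub>padic_vectors CHAR('k)\<^esub> t"
  interpret V: group "padic_vectors CHAR('k) :: ('n \<Rightarrow> padic) monoid"
    by (rule group_padic_vectors[OF prime_gt_0_nat[OF prime]])
  obtain k where k: "u \<in> level_ops (CHAR('k) ^ k)" using u diff_ring_carrier[OF prime] by blast
  have st: "?st \<in> carrier (padic_vectors CHAR('k))" using s t by simp
  have "conj_op (approx s k + approx t k) u = conj_op (approx ?st k) u"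
    using k by (rule conj_op_cong) (simp add: approx_def padic_vectors_def padic_add cong_def)
  then show ?thesis
    using padic_conj_level[OF prime s conj_op_mem[OF op_subalgebra_level_ops k, of "approx t k"]]
    by (simp add: padic_conj_level[OF prime _ k] s t st conj_op_conj_op)
qed

lemma padic_conj_one:
  fixes u :: "('n::finite, 'k::field) laurent_op"
  assumes "u \<in> carrier diff_ring"
  shows "padic_conj p \<one>\<^bsub>padic_vectors p\<^esub> u = u"
proof -
  have "approx \<one>\<^bsub>padic_vectors p\<^esub> k = (0 :: int ^ 'n)" for k
    by (simp add: approx_def padic_vectors_def padic_ring_def vec_eq_iff)
  then show ?thesis using assms by (simp add: padic_conj_def conj_op_zero)
qed

lemma padic_conj_mult_op: "padic_conj p s (mult_op a) = mult_op a"
  by (simp add: padic_conj_def mult_op_mem conj_op_mult_op)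

lemma padic_conj_Bij:
  fixes s :: "'n::finite \<Rightarrow> padic"
  assumes prime: "prime CHAR('k::field)" and s: "s \<in> carrier (padic_vectors CHAR('k))"
  shows "padic_conj CHAR('k) s \<in> Bij (carrier (diff_ring :: ('n, 'k) laurent_op ring))"
proof -
  interpret V: group "padic_vectors CHAR('k) :: ('n \<Rightarrow> padic) monoid"
    by (rule group_padic_vectors[OF prime_gt_0_nat[OF prime]])
  have "bij_betw (padic_conj CHAR('k) s) (carrier (diff_ring :: ('n, 'k) laurent_op ring)) (carrier diff_ring)"
    by (rule bij_betwI[where g = "padic_conj CHAR('k) (inv\<^bsub>padic_vectors CHAR('k)\<^esub> s)"])
      (use s in \<open>auto simp: padic_conj_mem padic_conj_compose[OF prime] padic_conj_one\<close>)
  then show ?thesis by (simp add: Bij_def padic_conj_def)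
qed

lemma laurent_scale_comp: "laurent_scale c \<circ> u = mult_op (Poly_Mapping.single 0 c) \<circ> u"
  by (simp add: fun_eq_iff laurent_scale_def mult_op_def)

lemma padic_conj_hom:
  fixes u v :: "('n::finite, 'k::field) laurent_op"
  assumes prime: "prime CHAR('k)" and s: "s \<in> carrier (padic_vectors CHAR('k))"
    and uv: "u \<in> carrier diff_ring" "v \<in> carrier diff_ring"
  shows "padic_conj CHAR('k) s (u \<circ> v) = padic_conj CHAR('k) s u \<circ> padic_conj CHAR('k) s v"
    and "padic_conj CHAR('k) s (\<lambda>f. u f + v f) = (\<lambda>f. padic_conj CHAR('k) s u f + padic_conj CHAR('k) s v f)"
proof -
  obtain k where k: "u \<in> level_ops (CHAR('k) ^ k)" "v \<in> level_ops (CHAR('k) ^ k)"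
    using diff_ring_common_level[OF prime uv] .
  then have "u \<circ> v \<in> level_ops (CHAR('k) ^ k)" "(\<lambda>f. u f + v f) \<in> level_ops (CHAR('k) ^ k)"
    using op_subalgebra_level_ops unfolding op_subalgebra_def by blast+
  note * = this k
  show "padic_conj CHAR('k) s (u \<circ> v) = padic_conj CHAR('k) s u \<circ> padic_conj CHAR('k) s v"
    unfolding *[THEN padic_conj_level[OF prime s]] by (rule conj_op_comp)
  show "padic_conj CHAR('k) s (\<lambda>f. u f + v f) = (\<lambda>f. padic_conj CHAR('k) s u f + padic_conj CHAR('k) s v f)"
    unfolding *[THEN padic_conj_level[OF prime s]] by (rule conj_op_add)
qed

lemma padic_conj_st_group:
  fixes s :: "'n::finite \<Rightarrow> padic"
  assumes prime: "prime CHAR('k::field)" and s: "s \<in> carrier (padic_vectors CHAR('k))"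
  shows "padic_conj CHAR('k) s \<in> carrier (st_group :: (('n, 'k) laurent_op \<Rightarrow> _) monoid)"
proof -
  have one: "\<one>\<^bsub>diff_ring\<^esub> = (mult_op 1 :: ('n, 'k) laurent_op)"
    by (simp add: diff_ring_def mult_op_def fun_eq_iff)
  have "padic_conj CHAR('k) s \<in> ring_hom diff_ring (diff_ring :: ('n, 'k) laurent_op ring)"
  proof (rule ring_hom_memI)
    fix u v :: "('n, 'k) laurent_op" assume uv: "u \<in> carrier diff_ring" "v \<in> carrier diff_ring"
    show "padic_conj CHAR('k) s (u \<otimes>\<^bsub>diff_ring\<^esub> v) =
        padic_conj CHAR('k) s u \<otimes>\<^bsub>diff_ring\<^esub> padic_conj CHAR('k) s v"
      using padic_conj_hom(1)[OF prime s uv] by (simp add: diff_ring_def del: diff_ops.simps)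
    show "padic_conj CHAR('k) s (u \<oplus>\<^bsub>diff_ring\<^esub> v) =
        padic_conj CHAR('k) s u \<oplus>\<^bsub>diff_ring\<^esub> padic_conj CHAR('k) s v"
      using padic_conj_hom(2)[OF prime s uv] by (simp add: diff_ring_def del: diff_ops.simps)
  qed (simp_all only: one padic_conj_mult_op padic_conj_mem)
  then show ?thesis
    using padic_conj_Bij[OF prime s]
    by (auto simp: st_group_def diff_aut_def padic_conj_mult_op laurent_scale_comp
        padic_conj_hom(1)[OF prime s mult_op_mem])
qed

section \<open>The characterization of sigma and the isomorphism\<close>

lemma diff_aut_D:
  fixes \<sigma> :: "('n::finite, 'k::field) laurent_op \<Rightarrow> ('n, 'k) laurent_op"
  assumes "\<sigma> \<in> carrier diff_aut"
  shows "\<sigma> \<in> extensional (carrier diff_ring)"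
    and "u \<in> carrier diff_ring \<Longrightarrow> \<sigma> u \<in> carrier diff_ring"
    and "u \<in> carrier diff_ring \<Longrightarrow> v \<in> carrier diff_ring \<Longrightarrow> \<sigma> (u \<circ> v) = \<sigma> u \<circ> \<sigma> v"
    and "u \<in> carrier diff_ring \<Longrightarrow> v \<in> carrier diff_ring \<Longrightarrow>
      \<sigma> (\<lambda>f. u f + v f) = (\<lambda>f. \<sigma> u f + \<sigma> v f)"
    and "u \<in> carrier diff_ring \<Longrightarrow> \<sigma> (laurent_scale c \<circ> u) = laurent_scale c \<circ> \<sigma> u"
    and "\<sigma> (mult_op 1) = mult_op 1"
proof -
  have h: "\<sigma> \<in> Bij (carrier diff_ring)" "\<sigma> \<in> ring_hom diff_ring diff_ring"
    using assms by (auto simp: diff_aut_def)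
  have one: "\<one>\<^bsub>diff_ring\<^esub> = (mult_op 1 :: ('n, 'k) laurent_op)"
    by (simp add: diff_ring_def mult_op_def fun_eq_iff)
  show "\<sigma> \<in> extensional (carrier diff_ring)" using h(1) by (rule Bij_imp_extensional)
  show "u \<in> carrier diff_ring \<Longrightarrow> \<sigma> u \<in> carrier diff_ring" by (rule ring_hom_closed[OF h(2)])
  show "u \<in> carrier diff_ring \<Longrightarrow> v \<in> carrier diff_ring \<Longrightarrow> \<sigma> (u \<circ> v) = \<sigma> u \<circ> \<sigma> v"
    using ring_hom_mult[OF h(2), of u v] by (simp add: diff_ring_def del: diff_ops.simps)
  show "u \<in> carrier diff_ring \<Longrightarrow> v \<in> carrier diff_ring \<Longrightarrow>
      \<sigma> (\<lambda>f. u f + v f) = (\<lambda>f. \<sigma> u f + \<sigma> v f)"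
    using ring_hom_add[OF h(2), of u v] by (simp add: diff_ring_def del: diff_ops.simps)
  show "u \<in> carrier diff_ring \<Longrightarrow> \<sigma> (laurent_scale c \<circ> u) = laurent_scale c \<circ> \<sigma> u"
    using assms by (simp add: diff_aut_def)
  show "\<sigma> (mult_op 1) = mult_op 1" using ring_hom_one[OF h(2)] unfolding one .
qed

text \<open>
  An automorphism that fixes the variables also fixes their inverses, and the hypothesis on inverses
  is what this contributes to the set \<open>S\<close> of fixed operators.
\<close>

lemma mult_op_generated_by_vars:
  fixes S :: "('n::finite, 'k::field) laurent_op set"
  assumes closed: "\<And>u v. u \<in> S \<Longrightarrow> v \<in> S \<Longrightarrow> u \<circ> v \<in> S \<and> (\<lambda>f. u f + v f) \<in> S"
    and scale: "\<And>c u. u \<in> S \<Longrightarrow> laurent_scale c \<circ> u \<in> S"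
    and one: "mult_op 1 \<in> S"
    and inv: "\<And>\<beta>. mult_op (Poly_Mapping.single \<beta> 1) \<in> S \<Longrightarrow> mult_op (Poly_Mapping.single (- \<beta>) 1) \<in> S"
    and var: "\<And>i. mult_op (laurent_var i) \<in> S"
  shows "mult_op a \<in> S"
proof -
  let ?x = "\<lambda>\<beta>. Poly_Mapping.single \<beta> 1 :: ('n, 'k) laurent"
  have mult: "mult_op (a * b) \<in> S" if "mult_op a \<in> S" "mult_op b \<in> S" for a b
  proof -
    have "mult_op (a * b) = mult_op a \<circ> mult_op b" by (simp add: mult_op_def fun_eq_iff mult.assoc)
    then show ?thesis using closed[OF that] by simp
  qed
  have addx: "mult_op (?x (\<beta> + \<gamma>)) \<in> S" if "mult_op (?x \<beta>) \<in> S" "mult_op (?x \<gamma>) \<in> S" for \<beta> \<gamma>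
    using mult[OF that] by (simp add: mult_single)
  have axis_nat: "mult_op (?x (axis i (int n))) \<in> S" for i n
  proof (induction n)
    case 0
    have "axis i (int 0) = (0 :: int ^ 'n)" by (simp add: axis_def vec_eq_iff)
    then show ?case using one by (simp only: single_one)
  next
    case (Suc n)
    have "axis i (int (Suc n)) = (axis i (int n) + axis i 1 :: int ^ 'n)" by (simp add: axis_def vec_eq_iff)
    then show ?case using addx[OF Suc var[of i, unfolded laurent_var_def]] by simp
  qed
  have axis: "mult_op (?x (axis i z)) \<in> S" for i z
  proof (cases "z \<ge> 0")
    case True
    then show ?thesis using axis_nat[of i "nat z"] by simp
  next
    case False
    then have "axis i z = (- axis i (int (nat (- z))) :: int ^ 'n)" by (simp add: axis_def vec_eq_iff)
    then show ?thesis using inv[OF axis_nat[of i "nat (- z)"]] by simp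
  qed
  have sums: "mult_op (?x (\<Sum>i\<in>A. axis i (\<beta> $ i))) \<in> S" if "finite A" for A \<beta>
    using that by induction (simp_all add: one addx axis)
  have x: "mult_op (?x \<beta>) \<in> S" for \<beta>
  proof -
    have "\<beta> = (\<Sum>i\<in>UNIV. axis i (\<beta> $ i))" by (simp add: vec_eq_iff axis_def)
    then show ?thesis using sums[of UNIV \<beta>] by simp
  qed
  have scaled: "mult_op (laurent_scale c b) \<in> S" if "mult_op b \<in> S" for c b
  proof -
    have "mult_op (laurent_scale c b) = laurent_scale c \<circ> mult_op b"
      by (simp add: mult_op_def laurent_scale_def fun_eq_iff mult.assoc)
    then show ?thesis using scale[OF that] by simp
  qed
  have "mult_op (\<Sum>\<beta>\<in>A. laurent_scale (c \<beta>) (?x \<beta>)) \<in> S" if "finite A" for A c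
    using that
  proof induction
    case empty
    have "laurent_scale 0 1 = (0 :: ('n, 'k) laurent)" by (simp add: laurent_scale_def)
    then show ?case using scaled[OF one, of 0] by simp
  next
    case (insert \<beta> A)
    have "mult_op (a + b) = (\<lambda>f. mult_op a f + mult_op b f)" for a b :: "('n, 'k) laurent"
      by (simp add: mult_op_def fun_eq_iff distrib_right)
    then show ?case using insert closed[OF scaled[OF x[of \<beta>]] insert.IH] by simp
  qed
  moreover have "a = (\<Sum>\<beta>\<in>Poly_Mapping.keys a. laurent_scale (Poly_Mapping.lookup a \<beta>) (?x \<beta>))"
    by (rule poly_mapping_eqI)
      (simp add: lookup_sum lookup_single when_def in_keys_iff laurent_scale_def mult_single)
  ultimately show ?thesis by (metis finite_keys)
qed

lemma is_sigma_fixes_mult_op: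
  fixes \<sigma> :: "('n::finite, 'k::field) laurent_op \<Rightarrow> ('n, 'k) laurent_op"
  assumes "is_sigma p s \<sigma>"
  shows "\<sigma> (mult_op a) = mult_op a"
proof -
  have \<sigma>: "\<sigma> \<in> carrier diff_aut" using assms by (simp add: is_sigma_def)
  note D = diff_aut_D[OF \<sigma>]
  let ?S = "{u \<in> carrier diff_ring. \<sigma> u = u}"
  have "mult_op a \<in> ?S"
  proof (rule mult_op_generated_by_vars)
    fix u v assume "u \<in> ?S" "v \<in> ?S"
    then show "u \<circ> v \<in> ?S \<and> (\<lambda>f. u f + v f) \<in> ?S"
      using op_subalgebra_diff_ring[where ?'n = 'n and ?'k = 'k] by (auto simp: op_subalgebra_def D(3,4))
  next
    fix c u assume "u \<in> ?S"
    then show "laurent_scale c \<circ> u \<in> ?S"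
      using op_subalgebra_diff_ring[where ?'n = 'n and ?'k = 'k] D(5)[of u c]
      by (auto simp: op_subalgebra_def laurent_scale_comp)
  next
    fix \<beta> assume a: "mult_op (Poly_Mapping.single \<beta> 1) \<in> ?S"
    let ?x = "\<lambda>\<beta>. mult_op (Poly_Mapping.single \<beta> 1) :: ('n, 'k) laurent_op"
    have inv: "?x \<beta> \<circ> ?x (- \<beta>) = mult_op 1" "?x (- \<beta>) \<circ> ?x \<beta> = mult_op 1"
      by (simp_all add: mult_op_def fun_eq_iff single_mult_assoc)
    have "?x \<beta> \<circ> \<sigma> (?x (- \<beta>)) = mult_op 1"
      using D(3)[OF mult_op_mem mult_op_mem, of "Poly_Mapping.single \<beta> 1" "Poly_Mapping.single (- \<beta>) 1"]
      using a D(6) inv by simp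
    then have "?x (- \<beta>) \<circ> (?x \<beta> \<circ> \<sigma> (?x (- \<beta>))) = ?x (- \<beta>) \<circ> mult_op 1" by simp
    then have "\<sigma> (?x (- \<beta>)) = ?x (- \<beta>)"
      unfolding comp_assoc[symmetric] inv(2) by (simp add: mult_op_def comp_def)
    then show "?x (- \<beta>) \<in> ?S" by (simp add: mult_op_mem)
  qed (use assms D(6) in \<open>auto simp: is_sigma_def mult_op_mem\<close>)
  then show ?thesis by simp
qed

lemma is_sigma_padic_conj:
  fixes s :: "'n::finite \<Rightarrow> padic"
  assumes prime: "prime CHAR('k::field)" and s: "s \<in> carrier (padic_vectors CHAR('k))"
  shows "is_sigma CHAR('k) s (padic_conj CHAR('k) s :: ('n, 'k) laurent_op \<Rightarrow> _)"
proof -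
  have "padic_conj CHAR('k) s (divided_diff \<alpha>) = (shifted_divided_diff CHAR('k) s \<alpha> :: ('n, 'k) laurent_op)" for \<alpha>
  proof -
    define K where "K = Max (range (($) \<alpha>))"
    have less: "\<alpha> $ i < CHAR('k) ^ K" for i
    proof -
      have "\<alpha> $ i \<le> K" unfolding K_def by (rule Max_ge) auto
      also have "K < CHAR('k) ^ K" by (rule power_gt_expt) (use prime_gt_1_nat[OF prime] in simp)
      finally show ?thesis .
    qed
    show ?thesis
      by (simp only: shifted_divided_diff_eq[OF prime s less]
          padic_conj_level[OF prime s divided_diff_level[OF prime less]])
  qed
  then show ?thesis
    using padic_conj_st_group[OF prime s] by (auto simp: is_sigma_def st_group_def)
qed

text \<open>
  The operators on which \<open>\<sigma>\<close> and \<open>\<tau>\<close> agree form a subalgebra. It contains the divided powers, hence all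
  the projections \<open>e\<^sub>q\<close>, and these generate the levels.
\<close>

lemma is_sigma_unique:
  fixes \<sigma> :: "('n::finite, 'k::field) laurent_op \<Rightarrow> ('n, 'k) laurent_op"
  assumes prime: "prime CHAR('k)" and \<sigma>: "is_sigma CHAR('k) s \<sigma>" and \<tau>: "is_sigma CHAR('k) s \<tau>"
  shows "\<sigma> = \<tau>"
proof -
  let ?S = "{u \<in> carrier diff_ring. \<sigma> u = \<tau> u}"
  have aut: "\<sigma> \<in> carrier diff_aut" "\<tau> \<in> carrier diff_aut" using \<sigma> \<tau> by (simp_all add: is_sigma_def)
  note D = aut[THEN diff_aut_D(3)] aut[THEN diff_aut_D(4)]
  have sub: "op_subalgebra ?S"
    using op_subalgebra_diff_ring[where ?'n = 'n and ?'k = 'k]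
    by (auto simp: op_subalgebra_def D is_sigma_fixes_mult_op[OF \<sigma>] is_sigma_fixes_mult_op[OF \<tau>])
  have dd: "divided_diff \<alpha> \<in> ?S" if "\<And>i. \<alpha> $ i < CHAR('k) ^ k" for \<alpha> k
    using divided_diff_level[OF prime that] level_ops_diff_ring[OF prime] \<sigma> \<tau>
    by (auto simp: is_sigma_def)
  have p: "CHAR('k) ^ k > 0" for k using prime_gt_0_nat[OF prime] by simp
  have "residue_proj (CHAR('k) ^ k) \<in> ?S" for k
  proof -
    have "divided_diff (\<chi> i. CHAR('k) ^ k - 1) \<in> ?S" by (rule dd[of _ k]) (use p[of k] in simp)
    then show ?thesis
      unfolding residue_proj_eq_divided_diff[OF prime] using sub unfolding op_subalgebra_def by blast
  qed
  then have "level_ops (CHAR('k) ^ k) \<subseteq> ?S" for k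
    by (intro level_ops_subset_subalgebra p sub)
  then have "\<sigma> u = \<tau> u" if "u \<in> carrier diff_ring" for u
    using that unfolding diff_ring_carrier[OF prime] by blast
  then show ?thesis using aut[THEN diff_aut_D(1)] by (intro extensionalityI[of \<sigma> "carrier diff_ring" \<tau>])
qed

text \<open>
  Conjugating \<open>e\<^sub>q\<close> by \<open>x\<^sup>m\<close> gives the projection onto the exponents congruent to \<open>-m\<close> modulo \<open>q\<close>, so the two
  sides can be told apart by applying them to \<open>x\<^sup>-\<^sup>m\<close>.
\<close>

lemma conj_op_residue_proj_cancel:
  fixes m n :: "int ^ 'n::finite"
  assumes "conj_op m (residue_proj q) = (conj_op n (residue_proj q) :: ('n, 'k::field) laurent_op)"
  shows "[m $ i = n $ i] (mod int q)"
proof -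
  have lk: "Poly_Mapping.lookup (conj_op l (residue_proj q) (Poly_Mapping.single (- m) (1::'k))) (- m) =
      (if \<forall>i. int q dvd (l - m) $ i then 1 else 0)" for l
    by (simp add: residue_proj_def conj_op_diag_op lookup_diag_op algebra_simps)
  have "\<forall>i. int q dvd (n - m) $ i"
    using lk[of m] lk[of n] assms by (auto split: if_splits)
  then show ?thesis by (simp add: cong_iff_dvd_diff dvd_diff_commute)
qed

lemma padic_conj_inj:
  fixes s t :: "'n::finite \<Rightarrow> padic"
  assumes prime: "prime CHAR('k::field)"
    and s: "s \<in> carrier (padic_vectors CHAR('k))" and t: "t \<in> carrier (padic_vectors CHAR('k))"
    and eq: "padic_conj CHAR('k) s = (padic_conj CHAR('k) t :: ('n, 'k) laurent_op \<Rightarrow> _)"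
  shows "s = t"
proof (intro ext)
  fix i k
  have "conj_op (approx s k) (residue_proj (CHAR('k) ^ k)) =
      (conj_op (approx t k) (residue_proj (CHAR('k) ^ k)) :: ('n, 'k) laurent_op)"
    using eq padic_conj_level[OF prime s residue_proj_level] padic_conj_level[OF prime t residue_proj_level]
    by metis
  then have "[approx s k $ i = approx t k $ i] (mod int (CHAR('k) ^ k))"
    by (rule conj_op_residue_proj_cancel)
  then show "s i k = t i k"
    using padic_mod[OF s[unfolded padic_vectors_mem, rule_format, of i], of k]
      padic_mod[OF t[unfolded padic_vectors_mem, rule_format, of i], of k]
    by (simp only: approx_def cong_def vec_lambda_beta of_nat_power)
qed

text \<open>
  The exponents by which \<open>\<sigma>\<close> conjugates on the various levels are compatible, because on \<open>e\<^sub>q\<close> the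
  exponent is determined modulo \<open>q\<close>. Their residues thus form a vector of p-adic integers.
\<close>

lemma st_group_padic_conj:
  fixes \<sigma> :: "('n::finite, 'k::field) laurent_op \<Rightarrow> ('n, 'k) laurent_op"
  assumes prime: "prime CHAR('k)" and \<sigma>: "\<sigma> \<in> carrier st_group"
  shows "\<exists>s\<in>carrier (padic_vectors CHAR('k)). \<sigma> = padic_conj CHAR('k) s"
proof -
  have aut: "\<sigma> \<in> carrier diff_aut" and fixed: "\<sigma> (mult_op a) = mult_op a" for a
    using \<sigma> by (simp_all add: st_group_def)
  note D = diff_aut_D[OF aut]
  have p: "CHAR('k) > 0" using prime_gt_0_nat[OF prime] .
  have "\<forall>k. \<exists>m. \<forall>u\<in>level_ops (CHAR('k) ^ k). \<sigma> u = conj_op m u"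
    using level_ops_conj[OF prime D(2-4) fixed] by blast
  then obtain m where m: "\<And>k u. u \<in> level_ops (CHAR('k) ^ k) \<Longrightarrow> \<sigma> u = conj_op (m k) u"
    by metis
  have "[m (Suc k) $ i = m k $ i] (mod int (CHAR('k) ^ k))" for k i
  proof (rule conj_op_residue_proj_cancel)
    let ?e = "residue_proj (CHAR('k) ^ k) :: ('n, 'k) laurent_op"
    have "?e \<in> level_ops (CHAR('k) ^ k)" "?e \<in> level_ops (CHAR('k) ^ Suc k)"
      using residue_proj_level level_ops_mono[of "CHAR('k) ^ k" "CHAR('k) ^ Suc k"] by auto
    then show "conj_op (m (Suc k)) ?e = conj_op (m k) ?e" using m by metis
  qed
  then have coherent: "[m (Suc k) $ i = m k $ i] (mod int CHAR('k) ^ k)" for k i by simp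
  define s where "s = (\<lambda>i k. m k $ i mod int CHAR('k) ^ k)"
  have s: "s \<in> carrier (padic_vectors CHAR('k))"
    unfolding padic_vectors_mem s_def by (intro allI padic_memI[OF p] coherent)
  have "\<sigma> u = padic_conj CHAR('k) s u" if u: "u \<in> carrier diff_ring" for u
  proof -
    obtain k where k: "u \<in> level_ops (CHAR('k) ^ k)" using u diff_ring_carrier[OF prime] by blast
    have "conj_op (m k) u = conj_op (approx s k) u"
      using k by (rule conj_op_cong) (simp add: approx_def s_def cong_def)
    then show ?thesis using m[OF k] padic_conj_level[OF prime s k] by simp
  qed
  then have "\<sigma> = padic_conj CHAR('k) s"
    using D(1) by (intro extensionalityI[of _ "carrier diff_ring"]) (auto simp: padic_conj_def)
  with s show ?thesis by blast
qed

lemma st_group_mult: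
  assumes "\<sigma> \<in> carrier st_group" "\<tau> \<in> carrier st_group"
  shows "\<sigma> \<otimes>\<^bsub>st_group\<^esub> \<tau> = compose (carrier diff_ring) \<sigma> \<tau>"
  using assms by (auto simp: st_group_def diff_aut_def BijGroup_def)

theorem theorem2p4:
  fixes p :: nat
  assumes "prime p" and "CHAR('k::field) = p"
  shows "(\<forall>s \<in> carrier (padic_vectors p :: ('n::finite \<Rightarrow> padic) monoid).
            \<exists>!\<sigma> :: ('n, 'k) laurent_op \<Rightarrow> ('n, 'k) laurent_op. is_sigma p s \<sigma>) \<and>
         (sigma p :: ('n \<Rightarrow> padic) \<Rightarrow> ('n, 'k) laurent_op \<Rightarrow> ('n, 'k) laurent_op)
            \<in> iso (padic_vectors p) st_group"
proof -
  have prime: "prime CHAR('k)" and p: "p = CHAR('k)" using assms by simp_all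
  let ?V = "padic_vectors p :: ('n \<Rightarrow> padic) monoid"
  let ?S = "st_group :: (('n, 'k) laurent_op \<Rightarrow> _) monoid"
  let ?\<sigma> = "padic_conj p :: ('n \<Rightarrow> padic) \<Rightarrow> ('n, 'k) laurent_op \<Rightarrow> ('n, 'k) laurent_op"
  interpret V: group ?V by (rule group_padic_vectors) (use assms(1) prime_gt_0_nat in blast)
  have ex1: "\<exists>!\<sigma> :: ('n, 'k) laurent_op \<Rightarrow> ('n, 'k) laurent_op. is_sigma p s \<sigma>" if "s \<in> carrier ?V" for s
    using is_sigma_padic_conj[OF prime that[unfolded p]] is_sigma_unique[OF prime] unfolding p by blast
  have sigma: "sigma p s = ?\<sigma> s" if "s \<in> carrier ?V" for s
    unfolding sigma_def using the1_equality[OF ex1[OF that]] is_sigma_padic_conj[OF prime that[unfolded p]]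
    unfolding p by blast
  have mem: "?\<sigma> s \<in> carrier ?S" if "s \<in> carrier ?V" for s
    using padic_conj_st_group[OF prime that[unfolded p]] unfolding p .
  have "?\<sigma> (s \<otimes>\<^bsub>?V\<^esub> t) = ?\<sigma> s \<otimes>\<^bsub>?S\<^esub> ?\<sigma> t" if "s \<in> carrier ?V" "t \<in> carrier ?V" for s t
    unfolding st_group_mult[OF mem[OF that(1)] mem[OF that(2)]]
    by (rule extensionalityI[of _ "carrier diff_ring"])
      (use that in \<open>auto simp: compose_def padic_conj_compose[OF prime] p\<close>, simp_all add: padic_conj_def)
  then have "sigma p \<in> hom ?V ?S"
    by (intro homI) (simp_all add: sigma mem)
  moreover have "inj_on (sigma p :: _ \<Rightarrow> ('n, 'k) laurent_op \<Rightarrow> _) (carrier ?V)"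
    by (rule inj_onI) (use padic_conj_inj[OF prime] sigma in \<open>simp add: p\<close>)
  moreover have "sigma p ` carrier ?V = carrier ?S"
    using st_group_padic_conj[OF prime] mem sigma unfolding p by (auto simp: image_iff)
  ultimately have "sigma p \<in> iso ?V ?S" by (simp add: iso_def bij_betw_def)
  with ex1 show ?thesis by blast
qed

end
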